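(* Let $m\ge 1$, $N\ge 0$, and let $S(z)=\sum_{n=-N}^{N}C_nz^n$, $C_n\in\mathbb{C}^{m\times m}$, $C_N\neq 0$, be an $m\times m$ Laurent polynomial matrix function of degree $N$ such that $S(z)$ is positive definite for almost every $z\in\mathbb{T}$. Suppose that $\det S$ has only simple roots in $\mathbb{C}\setminus\{0\}$. Let $p$ be any scalar polynomial spectral factor of $\det S$, i.e. $p(z)=\sum_{n=0}^{L}p_nz^n$ with $p_n\in\mathbb{C}$, where $L$ is the degree of the Laurent polynomial $\det S$, and $$p(z)\,\widetilde{p}(z)=\det S(z),\qquad z\in\mathbb{C}\setminus\{0\}.$$ Then there exists a polynomial matrix function $P(z)=\sum_{n=0}^{N}B_nz^n$, $B_n\in\mathbb{C}^{m\times m}$, such that $$P(z)\,\widetilde{P}(z)=S(z)\ \ (z\in\mathbb{C}\setminus\{0\})\qquad\text{and}\qquad \det P(z)=p(z)\ \ (z\in\mathbb{C}),$$ and it is unique up to a constant unitary right multiplier: if $P$ and $P_1$ are two such polynomial matrix functions, then $P(z)=P_1(z)U$ for all $z\in\mathbb{C}$, for some constant unitary matrix $U\in\mathbb{C}^{m\times m}$.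
   Context: $\mathbb{T}=\{z\in\mathbb{C}:|z|=1\}$. For a (scalar or matrix) polynomial function $P(z)=\sum_{n=0}^{N}B_nz^n$, its adjoint is $\widetilde{P}(z)=\overline{P(1/\overline{z})}^{\,T}=\sum_{n=0}^{N}B_n^*z^{-n}$, where $B_n^*=\overline{B_n}^{\,T}$. A Laurent polynomial $\sum_{n=-L}^{L}c_nz^n$ has degree $L$ if $c_L\ne 0$ (here $\det S$ is a scalar Laurent polynomial that is nonnegative on $\mathbb{T}$, so its coefficients satisfy $c_{-n}=\overline{c_n}$); similarly for matrix coefficients. *)

theory Defs
  imports "HOL-Complex_Analysis.Complex_Analysis"
begin

definition conj_transpose :: "complex^'m^'n \<Rightarrow> complex^'n^'m" where
  "conj_transpose A = transpose (map_matrix cnj A)"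

definition hermitian_inner :: "complex^'m \<Rightarrow> complex^'m \<Rightarrow> complex" where
  "hermitian_inner x y = (\<Sum>i\<in>UNIV. cnj (x $ i) * y $ i)"

definition pos_definite :: "complex^'m^'m \<Rightarrow> bool" where
  "pos_definite A \<longleftrightarrow>
     conj_transpose A = A \<and> (\<forall>x. x \<noteq> 0 \<longrightarrow> Re (hermitian_inner x (A *v x)) > 0)"

definition unitary_matrix :: "complex^'m^'m \<Rightarrow> bool" where
  "unitary_matrix U \<longleftrightarrow> conj_transpose U ** U = mat 1 \<and> U ** conj_transpose U = mat 1"

definition matrix_polynomial :: "nat \<Rightarrow> (complex \<Rightarrow> complex^'m^'m) \<Rightarrow> bool" where
  "matrix_polynomial N P \<longleftrightarrow>
     (\<exists>B :: nat \<Rightarrow> complex^'m^'m. \<forall>z. P z = (\<Sum>n\<le>N. map_matrix ((*) (z ^ n)) (B n)))"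

text \<open>
  Laurent polynomials are functions on the punctured plane: their (junk) value at \<open>0\<close> is
  never constrained.  As in the self-adjoint setting considered here, the degree is the largest
  positive exponent with a nonzero coefficient, all exponents being at least its negative.
\<close>

definition laurent_polynomial_of_degree :: "nat \<Rightarrow> (complex \<Rightarrow> complex) \<Rightarrow> bool" where
  "laurent_polynomial_of_degree L f \<longleftrightarrow>
     (\<exists>c :: int \<Rightarrow> complex. c (int L) \<noteq> 0 \<and>
        (\<forall>z. z \<noteq> 0 \<longrightarrow> f z = (\<Sum>n = - int L..int L. c n * z powi n)))"

definition matrix_laurent_polynomial_of_degree ::
    "nat \<Rightarrow> (complex \<Rightarrow> complex^'m^'m) \<Rightarrow> bool" where
  "matrix_laurent_polynomial_of_degree N S \<longleftrightarrow>
     (\<exists>C :: int \<Rightarrow> complex^'m^'m. C (int N) \<noteq> 0 \<and>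
        (\<forall>z. z \<noteq> 0 \<longrightarrow> S z = (\<Sum>n = - int N..int N. map_matrix ((*) (z powi n)) (C n))))"

text \<open>The adjoint \<open>z \<mapsto> P(1/\<bar>z)\<^sup>*\<close>, meaningful for \<open>z \<noteq> 0\<close>, for scalar and for matrix functions.\<close>

definition adj_fun :: "(complex \<Rightarrow> complex) \<Rightarrow> complex \<Rightarrow> complex" where
  "adj_fun f z = cnj (f (1 / cnj z))"

definition adj_mat_fun :: "(complex \<Rightarrow> complex^'m^'n) \<Rightarrow> complex \<Rightarrow> complex^'n^'m" where
  "adj_mat_fun P z = conj_transpose (P (1 / cnj z))"

end

theory Submission
  imports Defs "HOL-Computational_Algebra.Fundamental_Theorem_Algebra"
begin

text \<open>
  Gaussian elimination over the Laurent polynomials together with the scalar Fejer--Riesz theorem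
  gives a polynomial matrix \<open>R\<close> and a scalar polynomial \<open>\<rho>\<close> with \<open>R R\<^sup>* = \<bar>\<rho>\<bar>\<^sup>2 S\<close> on the unit circle.
  If \<open>det R\<close> vanishes at \<open>a\<close>, say \<open>R(a) v = 0\<close> with a unit vector \<open>v\<close>, then multiplying \<open>R\<close> on the
  right by \<open>I + (b - 1) v v\<^sup>*\<close>, where \<open>b(z) = (1 - cnj a z) / (z - a)\<close>, keeps \<open>R R\<^sup>*\<close> on the circle
  (where \<open>\<bar>b\<bar> = 1\<close>) and moves this zero of the determinant to \<open>1 / cnj a\<close>. Such flips serve to
  cancel \<open>\<rho>\<close>, and then to put the zeros of the determinant exactly at those of \<open>p\<close>.
  For uniqueness, the quotient \<open>U\<close> of two solutions is polynomial because the zeros of \<open>p\<close> are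
  simple and not shared with the adjoint of \<open>p\<close>; its determinant is 1, so its adjoint, being its
  inverse, is polynomial as well, and \<open>U\<close> is constant.
\<close>

section \<open>Polynomial and Laurent polynomial matrices\<close>

no_notation fps_nth (infixl "$" 75)

text \<open>Two facts about \<open>p\<close> carry the argument: its zeros are simple, and no zero
  is the reflection \<open>1 / cnj a\<close> of a zero. A violation of either would make some zero
  of \<open>det S\<close> multiple. As a point of the circle is its own reflection,
  \<open>det S\<close> has no zero there, and positivity almost everywhere becomes positivity at
  every point of the circle. From then on identities are proved on the circle, where the adjoint is
  the conjugate transpose, and carried to all \<open>z \<noteq> 0\<close> because both sides are
  Laurent. The origin needs separate care, since its reflection is infinity. That \<open>L\<close>
  is the degree of \<open>det S\<close> gives \<open>poly p 0 \<noteq> 0\<close>; flips are stated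
  so that they also remove zeros at the origin; and invertibility of \<open>P\<close> at the origin
  is what bounds the degree of \<open>P\<close> by \<open>N\<close>, a bound that the construction,
  which raises degrees freely, does not provide by itself.\<close>

definition eval_mat :: "complex poly^'n^'m \<Rightarrow> complex \<Rightarrow> complex^'n^'m" where
  "eval_mat P z = map_matrix (\<lambda>q. poly q z) P"

lemma eval_mat_nth [simp]: "eval_mat P z $ i $ j = poly (P $ i $ j) z"
  by (simp add: eval_mat_def)

lemma eval_mat_mult: "eval_mat (P ** Q) z = eval_mat P z ** eval_mat Q z"
  by (simp add: vec_eq_iff matrix_matrix_mult_def poly_sum)

lemma det_eval_mat: "det (eval_mat P z) = poly (det P) z"
  by (simp add: det_def poly_sum poly_prod)

lemma poly_eqI_infinite:
  fixes p q :: "'a::{idom,ring_char_0} poly"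
  assumes "infinite A" "\<And>z. z \<in> A \<Longrightarrow> poly p z = poly q z"
  shows "p = q"
proof (rule ccontr)
  assume "p \<noteq> q"
  hence "finite {z. poly (p - q) z = 0}" by (intro poly_roots_finite) simp
  moreover have "A \<subseteq> {z. poly (p - q) z = 0}" using assms(2) by auto
  ultimately show False using assms(1) finite_subset by blast
qed

lemma eval_mat_eqI_infinite:
  assumes "infinite A" "\<And>z. z \<in> A \<Longrightarrow> eval_mat P z = eval_mat Q z"
  shows "P = Q"
proof -
  have "P $ i $ j = Q $ i $ j" for i j
    by (rule poly_eqI_infinite[OF assms(1)]) (metis assms(2) eval_mat_nth)
  thus ?thesis by (simp add: vec_eq_iff)
qed

lemma infinite_unit_circle: "infinite (sphere 0 1 :: complex set)"
proof
  assume "finite (sphere 0 1 :: complex set)"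
  moreover have "{-1..1} \<subseteq> Re ` sphere 0 1"
  proof
    fix x :: real assume "x \<in> {-1..1}"
    hence "x\<^sup>2 \<le> 1" by (auto simp: abs_square_le_1)
    hence "norm (Complex x (sqrt (1 - x\<^sup>2))) = 1" by (simp add: cmod_def)
    thus "x \<in> Re ` sphere 0 1" by (intro image_eqI[of _ _ "Complex x (sqrt (1 - x\<^sup>2))"]) auto
  qed
  ultimately have "finite {-1..1::real}" using finite_surj by blast
  thus False by (simp add: infinite_Icc)
qed

text \<open>Clearing the denominator instead of listing coefficients makes the closure properties
  one-line polynomial identities. The value at 0 stays unconstrained.\<close>

definition laurent :: "(complex \<Rightarrow> complex) \<Rightarrow> bool" where
  "laurent f \<longleftrightarrow> (\<exists>n q. \<forall>z. z \<noteq> 0 \<longrightarrow> f z * z ^ n = poly q z)"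

lemma laurent_poly: "laurent (poly q)"
  unfolding laurent_def by (intro exI[of _ 0] exI[of _ q]) simp

lemma laurent_const: "laurent (\<lambda>_. c)"
  using laurent_poly[of "[:c:]"] by (simp add: laurent_def)

lemma laurent_add:
  assumes "laurent f" "laurent g" shows "laurent (\<lambda>z. f z + g z)"
proof -
  obtain n q where q: "z \<noteq> 0 \<Longrightarrow> f z * z ^ n = poly q z" for z using assms(1) by (auto simp: laurent_def)
  obtain k r where r: "z \<noteq> 0 \<Longrightarrow> g z * z ^ k = poly r z" for z using assms(2) by (auto simp: laurent_def)
  have "(f z + g z) * z ^ (n + k) = poly (q * monom 1 k + r * monom 1 n) z" if "z \<noteq> 0" for z
    by (simp add: poly_monom power_add algebra_simps flip: q[OF that] r[OF that])
  thus ?thesis unfolding laurent_def by blast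
qed

lemma laurent_mult:
  assumes "laurent f" "laurent g" shows "laurent (\<lambda>z. f z * g z)"
proof -
  obtain n q where q: "z \<noteq> 0 \<Longrightarrow> f z * z ^ n = poly q z" for z using assms(1) by (auto simp: laurent_def)
  obtain k r where r: "z \<noteq> 0 \<Longrightarrow> g z * z ^ k = poly r z" for z using assms(2) by (auto simp: laurent_def)
  have "(f z * g z) * z ^ (n + k) = poly (q * r) z" if "z \<noteq> 0" for z
    by (simp add: power_add algebra_simps flip: q[OF that] r[OF that])
  thus ?thesis unfolding laurent_def by blast
qed

lemma laurent_uminus: "laurent f \<Longrightarrow> laurent (\<lambda>z. - f z)"
  using laurent_mult[OF laurent_const[of "-1"]] by simp

lemma laurent_if: "laurent f \<Longrightarrow> laurent g \<Longrightarrow> laurent (\<lambda>z. if b then f z else g z)"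
  by (cases b) auto

lemma laurent_sum: "(\<And>i. i \<in> I \<Longrightarrow> laurent (f i)) \<Longrightarrow> laurent (\<lambda>z. \<Sum>i\<in>I. f i z)"
  by (induction I rule: infinite_finite_induct) (auto intro: laurent_const laurent_add)

lemma laurent_powi: "laurent (\<lambda>z. z powi n)"
proof (cases "n \<ge> 0")
  case True
  have "z powi n * z ^ 0 = poly (monom 1 (nat n)) z" for z :: complex
    using True by (simp add: poly_monom power_int_def)
  thus ?thesis unfolding laurent_def by blast
next
  case False
  have "z powi n * z ^ nat (- n) = poly 1 z" if "z \<noteq> 0" for z :: complex
    using False that by (simp add: power_int_def field_simps)
  thus ?thesis unfolding laurent_def by blast
qed

text \<open>Turns the adjoint of a polynomial into a polynomial divided by a power of
  \<open>z\<close>, so that degree and root counting apply to it.\<close>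

lemma poly_reflect_cnj:
  assumes "z \<noteq> 0"
  shows "poly (reflect_poly (map_poly cnj q)) z = z ^ degree q * cnj (poly q (1 / cnj z))"
proof -
  have "degree (map_poly cnj q) = degree q" by (rule degree_map_poly) auto
  thus ?thesis using assms by (simp add: poly_reflect_poly_nz inverse_eq_divide)
qed

lemma laurent_adj:
  assumes "laurent f" shows "laurent (adj_fun f)"
proof -
  obtain n q where q: "z \<noteq> 0 \<Longrightarrow> f z * z ^ n = poly q z" for z using assms by (auto simp: laurent_def)
  have "adj_fun f z * z ^ degree q = poly (monom 1 n * reflect_poly (map_poly cnj q)) z" if "z \<noteq> 0" for z
  proof -
    have "cnj (f (1 / cnj z)) * (1 / z) ^ n = cnj (poly q (1 / cnj z))"
      using q[of "1 / cnj z"] that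
      by (metis (no_types, lifting) complex_cnj_cnj complex_cnj_divide complex_cnj_mult complex_cnj_one
          complex_cnj_power complex_cnj_zero_iff divide_eq_0_iff zero_neq_one)
    thus ?thesis using that by (simp add: poly_reflect_cnj poly_monom adj_fun_def field_simps)
  qed
  thus ?thesis unfolding laurent_def by blast
qed

lemma laurent_continuous:
  assumes "laurent f" shows "continuous_on (- {0}) f"
proof -
  obtain n q where q: "z \<noteq> 0 \<Longrightarrow> f z * z ^ n = poly q z" for z using assms by (auto simp: laurent_def)
  have "continuous_on (- {0}) (\<lambda>z. poly q z / z ^ n)" by (intro continuous_intros) auto
  thus ?thesis by (rule continuous_on_eq) (auto simp flip: q)
qed

text \<open>After clearing powers of \<open>z\<close>, two polynomials agree on the infinite unit
  circle. This is the passage from identities with \<open>cnj\<close> on the circle to identities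
  with \<open>adj_fun\<close> on the punctured plane.\<close>

lemma laurent_eqI:
  assumes "laurent f" "laurent g" "\<And>z. norm z = 1 \<Longrightarrow> f z = g z" "z \<noteq> 0"
  shows "f z = g z"
proof -
  obtain n q where q: "z \<noteq> 0 \<Longrightarrow> f z * z ^ n = poly q z" for z using assms(1) by (auto simp: laurent_def)
  obtain k r where r: "z \<noteq> 0 \<Longrightarrow> g z * z ^ k = poly r z" for z using assms(2) by (auto simp: laurent_def)
  have "q * monom 1 k = r * monom 1 n"
  proof (rule poly_eqI_infinite[OF infinite_unit_circle])
    fix z :: complex assume "z \<in> sphere 0 1"
    hence z: "norm z = 1" "z \<noteq> 0" by auto
    show "poly (q * monom 1 k) z = poly (r * monom 1 n) z"
      using assms(3)[OF z(1)] by (simp add: poly_monom flip: q[OF z(2)] r[OF z(2)])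
  qed
  hence "poly (q * monom 1 k) z = poly (r * monom 1 n) z" by simp
  thus ?thesis using assms(4) by (simp add: poly_monom flip: q[OF assms(4)] r[OF assms(4)])
qed

definition laurent_mat :: "(complex \<Rightarrow> complex^'n^'m) \<Rightarrow> bool" where
  "laurent_mat A \<longleftrightarrow> (\<forall>i j. laurent (\<lambda>z. A z $ i $ j))"

lemma laurent_mat_eval: "laurent_mat (eval_mat P)"
  by (simp add: laurent_mat_def laurent_poly)

lemma laurent_mat_mult:
  "laurent_mat A \<Longrightarrow> laurent_mat B \<Longrightarrow> laurent_mat (\<lambda>z. A z ** B z)"
  by (auto simp: laurent_mat_def matrix_matrix_mult_def intro!: laurent_sum laurent_mult)

lemma adj_mat_fun_nth: "adj_mat_fun A z $ i $ j = adj_fun (\<lambda>z. A z $ j $ i) z"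
  by (simp add: adj_mat_fun_def adj_fun_def conj_transpose_def transpose_def)

lemma laurent_mat_adj: "laurent_mat A \<Longrightarrow> laurent_mat (adj_mat_fun A)"
  by (auto simp: laurent_mat_def adj_mat_fun_nth intro: laurent_adj)

lemma laurent_mat_eqI:
  assumes "laurent_mat A" "laurent_mat B" "\<And>z. norm z = 1 \<Longrightarrow> A z = B z" "z \<noteq> 0"
  shows "A z = B z"
proof -
  have "A z $ i $ j = B z $ i $ j" for i j
    by (rule laurent_eqI[of "\<lambda>z. A z $ i $ j" "\<lambda>z. B z $ i $ j"])
      (use assms in \<open>auto simp: laurent_mat_def\<close>)
  thus ?thesis by (simp add: vec_eq_iff)
qed

section \<open>Adjoints on the unit circle and scalar multiples of matrices\<close>

lemma inverse_cnj_unit: "norm z = 1 \<Longrightarrow> 1 / cnj z = (z :: complex)"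
  by (metis complex_cnj_cnj complex_norm_square mult.commute nonzero_eq_divide_eq norm_zero of_real_1 one_power2 zero_neq_one complex_cnj_zero_iff)

lemma adj_fun_unit: "norm z = 1 \<Longrightarrow> adj_fun f z = cnj (f z)"
  by (simp add: adj_fun_def inverse_cnj_unit)

lemma adj_mat_fun_unit: "norm z = 1 \<Longrightarrow> adj_mat_fun A z = conj_transpose (A z)"
  by (simp add: adj_mat_fun_def inverse_cnj_unit)

lemma conj_transpose_nth [simp]: "conj_transpose A $ i $ j = cnj (A $ j $ i)"
  by (simp add: conj_transpose_def transpose_def)

lemma conj_transpose_mult: "conj_transpose (A ** B) = conj_transpose B ** conj_transpose A"
  by (simp add: vec_eq_iff matrix_matrix_mult_def mult.commute)

lemma conj_transpose_conj_transpose [simp]: "conj_transpose (conj_transpose A) = A"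
  by (simp add: vec_eq_iff)

lemma det_conj_transpose: "det (conj_transpose A) = cnj (det A)"
proof -
  have "det (map_matrix cnj A) = cnj (det A)" by (simp add: det_def)
  thus ?thesis by (simp add: conj_transpose_def)
qed

abbreviation smult_mat :: "'a::times \<Rightarrow> 'a^'n^'m \<Rightarrow> 'a^'n^'m" (infixr "*\<^sub>m" 75) where
  "c *\<^sub>m A \<equiv> map_matrix ((*) c) A"

lemma smult_mat_mult_left: "(c *\<^sub>m A) ** B = c *\<^sub>m (A ** B)"
  by (simp add: vec_eq_iff matrix_matrix_mult_def sum_distrib_left mult.assoc)

lemma smult_mat_mult_right: "A ** (c *\<^sub>m B) = (c::'a::comm_semiring_1) *\<^sub>m (A ** B)"
  by (simp add: vec_eq_iff matrix_matrix_mult_def sum_distrib_left mult_ac)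

lemma smult_mat_smult_mat [simp]: "a *\<^sub>m b *\<^sub>m A = (a * b :: 'a::semigroup_mult) *\<^sub>m A"
  by (simp add: vec_eq_iff mult.assoc)

lemma smult_mat_one [simp]: "(1::'a::monoid_mult) *\<^sub>m A = A"
  by (simp add: vec_eq_iff)

lemma conj_transpose_smult_mat [simp]: "conj_transpose (c *\<^sub>m A) = cnj c *\<^sub>m conj_transpose A"
  by (simp add: vec_eq_iff)

lemma eval_mat_smult_mat [simp]: "eval_mat (q *\<^sub>m A) z = poly q z *\<^sub>m eval_mat A z"
  by (simp add: vec_eq_iff)

lemma eval_mat_one [simp]: "eval_mat (mat 1) z = mat 1"
  by (simp add: vec_eq_iff mat_def)

lemma det_smult_mat: "det (c *\<^sub>m A) = (c::'a::comm_ring_1) ^ CARD('n) * det (A :: 'a^'n^'n)"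
proof -
  have "c *\<^sub>m A = (\<chi> i. c *s A $ i)" by (simp add: vec_eq_iff)
  thus ?thesis using det_rows_mul[of "\<lambda>_. c" "\<lambda>i. A $ i"] by simp
qed

lemma laurent_smult_mat: "laurent f \<Longrightarrow> laurent_mat A \<Longrightarrow> laurent_mat (\<lambda>z. f z *\<^sub>m A z)"
  by (auto simp: laurent_mat_def intro: laurent_mult)

text \<open>Polynomials form no field, so \<open>Q\<close> is written down by Cramer's rule: column
  \<open>k\<close> of \<open>P\<close> is replaced by the \<open>j\<close>-th unit vector. The two
  identities are checked by evaluation at the infinitely many points where \<open>det P\<close> is
  nonzero, where \<open>eval_mat P z\<close> has an inverse.\<close>

lemma adjugate_poly_mat:
  fixes P :: "complex poly^'m^'m"
  assumes "det P \<noteq> 0"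
  obtains Q where "P ** Q = det P *\<^sub>m mat 1" "Q ** P = det P *\<^sub>m mat 1"
proof -
  define Q :: "complex poly^'m^'m" where
    "Q = (\<chi> k j. det (\<chi> i l. if l = k then (if i = j then 1 else 0) else P $ i $ l))"
  define A where "A = {z. poly (det P) z \<noteq> 0}"
  have "A = UNIV - {z. poly (det P) z = 0}" by (auto simp: A_def)
  hence inf: "infinite A"
    using Diff_infinite_finite[OF poly_roots_finite[OF assms]] infinite_UNIV_char_0 by metis
  have *: "eval_mat P z ** eval_mat Q z = poly (det P) z *\<^sub>m mat 1" if "z \<in> A" for z
  proof -
    define M where "M = eval_mat P z"
    have d: "det M \<noteq> 0" using that by (simp add: M_def A_def det_eval_mat)
    then obtain B where B: "M ** B = mat 1" "B ** M = mat 1"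
      using invertible_det_nz[of M] by (auto simp: invertible_def)
    have "eval_mat Q z $ k $ j = det M * B $ k $ j" for k j
    proof -
      have *: "M *v column j B = axis j 1"
      proof -
        have "(M *v column j B) $ i = (M ** B) $ i $ j" for i
          by (simp add: matrix_vector_mult_def matrix_matrix_mult_def column_def)
        thus ?thesis by (simp add: vec_eq_iff B(1) mat_def axis_def)
      qed
      have "eval_mat Q z $ k $ j = det (eval_mat (\<chi> i l. if l = k then (if i = j then 1 else 0) else P $ i $ l) z)"
        by (simp add: Q_def det_eval_mat)
      also have "eval_mat (\<chi> i l. if l = k then (if i = j then 1 else 0) else P $ i $ l) z
        = (\<chi> i l. if l = k then (M *v column j B) $ i else M $ i $ l)"
        unfolding * by (simp add: M_def vec_eq_iff axis_def)
      also have "det \<dots> = det M * B $ k $ j"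
        by (subst cramer_lemma) (simp add: column_def)
      finally show ?thesis .
    qed
    hence "eval_mat Q z = det M *\<^sub>m B" by (simp add: vec_eq_iff)
    thus ?thesis using B by (simp add: smult_mat_mult_right M_def det_eval_mat)
  qed
  have **: "eval_mat Q z ** eval_mat P z = poly (det P) z *\<^sub>m mat 1" if "z \<in> A" for z
  proof -
    have d: "poly (det P) z \<noteq> 0" using that by (simp add: A_def)
    have "eval_mat P z ** (inverse (poly (det P) z) *\<^sub>m eval_mat Q z) = mat 1"
      using *[OF that] d by (simp add: smult_mat_mult_right)
    hence "(inverse (poly (det P) z) *\<^sub>m eval_mat Q z) ** eval_mat P z = mat 1"
      by (rule matrix_left_right_inverse1)
    hence "inverse (poly (det P) z) *\<^sub>m (eval_mat Q z ** eval_mat P z) = mat 1"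
      by (simp add: smult_mat_mult_left)
    hence "poly (det P) z *\<^sub>m (inverse (poly (det P) z) *\<^sub>m (eval_mat Q z ** eval_mat P z)) = poly (det P) z *\<^sub>m mat 1"
      by simp
    thus ?thesis using d by simp
  qed
  show ?thesis
    by (rule that[of Q]; rule eval_mat_eqI_infinite[OF inf]) (simp_all add: eval_mat_mult * **)
qed

section \<open>Positive definite matrices and elimination\<close>

lemma hermitian_inner_adjoint:
  "hermitian_inner x (A *v y) = hermitian_inner (conj_transpose A *v x) y"
proof -
  have "hermitian_inner x (A *v y) = (\<Sum>i\<in>UNIV. \<Sum>j\<in>UNIV. cnj (x $ i) * A $ i $ j * y $ j)"
    by (simp add: hermitian_inner_def matrix_vector_mult_def sum_distrib_left mult.assoc)
  also have "\<dots> = (\<Sum>j\<in>UNIV. \<Sum>i\<in>UNIV. cnj (x $ i) * A $ i $ j * y $ j)"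
    by (rule sum.swap)
  also have "\<dots> = hermitian_inner (conj_transpose A *v x) y"
    by (simp add: hermitian_inner_def matrix_vector_mult_def sum_distrib_right sum_distrib_left mult_ac)
  finally show ?thesis .
qed

lemma det_zero_imp_kernel:
  fixes A :: "'a::field^'n^'n"
  assumes "det A = 0" obtains x where "x \<noteq> 0" "A *v x = 0"
  using assms invertible_det_nz[of A] matrix_left_invertible_ker[of A] by (auto simp: invertible_left_inverse)

lemma kernel_imp_det_zero:
  fixes A :: "'a::field^'n^'n"
  assumes "x \<noteq> 0" "A *v x = 0" shows "det A = 0"
  using assms invertible_det_nz[of A] matrix_left_invertible_ker[of A] by (auto simp: invertible_left_inverse)

lemma pos_definite_det_nonzero:
  assumes "pos_definite A" shows "det A \<noteq> 0"
proof
  assume "det A = 0"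
  then obtain x where "x \<noteq> 0" "A *v x = 0" by (rule det_zero_imp_kernel)
  thus False using assms by (auto simp: pos_definite_def hermitian_inner_def)
qed

lemma pos_definite_congruence:
  assumes "pos_definite D" "det E \<noteq> 0"
  shows "pos_definite (E ** D ** conj_transpose E)"
  unfolding pos_definite_def
proof (intro conjI allI impI)
  show "conj_transpose (E ** D ** conj_transpose E) = E ** D ** conj_transpose E"
    using assms(1) by (simp add: conj_transpose_mult matrix_mul_assoc pos_definite_def)
next
  fix x :: "complex^'a" assume "x \<noteq> 0"
  define y where "y = conj_transpose E *v x"
  have "y \<noteq> 0"
    using kernel_imp_det_zero[OF \<open>x \<noteq> 0\<close>, of "conj_transpose E"] assms(2) by (auto simp: y_def det_conj_transpose)
  hence "Re (hermitian_inner y (D *v y)) > 0" using assms(1) by (simp add: pos_definite_def)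
  moreover have "(E ** D ** conj_transpose E) *v x = E *v (D *v y)"
    by (simp add: y_def matrix_vector_mul_assoc matrix_mul_assoc)
  ultimately show "Re (hermitian_inner x ((E ** D ** conj_transpose E) *v x)) > 0"
    by (simp add: hermitian_inner_adjoint[of x E] y_def)
qed

lemma pos_definite_diag:
  assumes "pos_definite A" shows "\<exists>x>0. A $ i $ i = of_real x"
proof -
  have "(axis i 1 :: complex^'a) \<noteq> 0" by (simp add: axis_eq_0_iff)
  hence "Re (hermitian_inner (axis i 1) (A *v axis i 1)) > 0" using assms by (simp add: pos_definite_def)
  moreover have "hermitian_inner (axis i 1) (A *v axis i 1) = A $ i $ i"
    by (simp add: hermitian_inner_def matrix_vector_mult_def axis_def if_distrib[of cnj] if_distrib[of "\<lambda>x. _ * x"]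
        if_distrib[of "\<lambda>x. x * _"] cong: if_cong)
  moreover have "cnj (A $ i $ i) = A $ i $ i"
    using assms conj_transpose_nth[of A i i] by (simp add: pos_definite_def)
  ultimately show ?thesis
    by (metis Reals_cnj_iff complex_is_Real_iff of_real_Re)
qed

text \<open>An elementary elimination matrix cleared of denominators: rows are scaled by the pivot
  \<open>s\<close> rather than the multipliers divided by it, so Laurent entries stay
  Laurent.\<close>

definition column_elimination :: "'a::comm_ring_1 \<Rightarrow> ('m \<Rightarrow> 'a) \<Rightarrow> 'm \<Rightarrow> 'a^'m^'m" where
  "column_elimination s y k = (\<chi> i j. (if i = j then s else 0) + (if j = k then y i else 0))"

lemma column_elimination_mult:
  "(column_elimination s y k ** M) $ i $ j = s * M $ i $ j + y i * M $ k $ j"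
  by (simp add: column_elimination_def matrix_matrix_mult_def distrib_right sum.distrib
     if_distrib[of "\<lambda>x. x * _"] cong: if_cong)

lemma mult_column_elimination:
  "(M ** conj_transpose (column_elimination s y k)) $ i $ j = cnj s * M $ i $ j + cnj (y j) * M $ i $ k"
proof -
  have "M ** conj_transpose (column_elimination s y k) =
      conj_transpose (column_elimination s y k ** conj_transpose M)"
    by (simp add: conj_transpose_mult)
  thus ?thesis by (simp add: column_elimination_mult)
qed

text \<open>The part carrying \<open>y\<close> squares to \<open>y k\<close> times itself, hence to
  zero.\<close>

lemma column_elimination_inverse:
  assumes "y k = 0"
  shows "column_elimination s y k ** column_elimination s (\<lambda>i. - y i) k = (s * s) *\<^sub>m mat 1"
  using assms by (auto simp: vec_eq_iff column_elimination_mult) (auto simp: column_elimination_def mat_def)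

text \<open>Symmetric elimination, one index at a time; \<open>I\<close> collects the indices whose
  rows are already diagonal. Congruence preserves positive definiteness, so every pivot is positive
  on the circle and no row exchange is ever needed. The pivots that are multiplied in, instead of
  divided out, accumulate in \<open>\<rho>\<close>.\<close>

lemma congruent_diagonal:
  fixes S :: "complex \<Rightarrow> complex^'m^'m"
  assumes "laurent_mat S" "\<And>z. norm z = 1 \<Longrightarrow> pos_definite (S z)" "finite I"
  shows "\<exists>(R :: complex \<Rightarrow> complex^'m^'m) (D :: complex \<Rightarrow> complex^'m^'m) \<rho>. laurent_mat R \<and> laurent_mat D \<and> laurent \<rho> \<and>
    (\<forall>z. norm z = 1 \<longrightarrow> \<rho> z \<noteq> 0 \<and> pos_definite (D z) \<and>
      R z ** D z ** conj_transpose (R z) = (\<rho> z * cnj (\<rho> z)) *\<^sub>m S z \<and>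
      (\<forall>i\<in>I. \<forall>j. j \<noteq> i \<longrightarrow> D z $ i $ j = 0))"
  using assms(3)
proof induction
  case empty
  show ?case
  proof (rule exI[of _ "\<lambda>_. mat 1 :: complex^'m^'m"], rule exI[of _ S], rule exI[of _ "\<lambda>_. 1 :: complex"],
      intro conjI allI impI ballI)
    show "laurent_mat (\<lambda>_. mat 1 :: complex^'m^'m)"
      by (simp add: laurent_mat_def laurent_const)
    fix z :: complex assume "norm z = 1"
    have "conj_transpose (mat 1 :: complex^'m^'m) = mat 1" by (simp add: vec_eq_iff mat_def)
    thus "mat 1 ** S z ** conj_transpose (mat 1) = (1 * cnj 1) *\<^sub>m S z" by simp
  qed (use assms in \<open>auto simp: laurent_const\<close>)
next
  case (insert k I)
  then obtain R D :: "complex \<Rightarrow> complex^'m^'m" and \<rho> where L: "laurent_mat R" "laurent_mat D" "laurent \<rho>"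
    and *: "\<forall>z. norm z = 1 \<longrightarrow> \<rho> z \<noteq> 0 \<and> pos_definite (D z) \<and>
      R z ** D z ** conj_transpose (R z) = (\<rho> z * cnj (\<rho> z)) *\<^sub>m S z \<and>
      (\<forall>i\<in>I. \<forall>j. j \<noteq> i \<longrightarrow> D z $ i $ j = 0)" by blast
  define s where "s z = D z $ k $ k" for z
  define y where "y z j = (if j = k then 0 else D z $ j $ k)" for z j
  define E where "E z = column_elimination (s z) (\<lambda>i. - y z i) k" for z
  define F where "F z = column_elimination (s z) (y z) k" for z
  \<comment> \<open>The conjugate transpose of a Laurent matrix is not Laurent in \<open>z\<close>;
    the adjoint is, and it agrees with it on the circle.\<close>
  define D' where "D' z = E z ** D z ** adj_mat_fun E z" for z
  have "s = (\<lambda>z. D z $ k $ k)" by (simp add: fun_eq_iff s_def)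
  hence Ls: "laurent s" using L(2) by (simp add: laurent_mat_def)
  have Ly: "laurent (\<lambda>z. y z i)" for i
    using L(2) by (cases "i = k") (auto simp: y_def laurent_mat_def laurent_const)
  have LE: "laurent_mat E"
    unfolding laurent_mat_def E_def column_elimination_def
    by (auto intro!: laurent_add laurent_if laurent_uminus laurent_const Ls Ly)
  have LF: "laurent_mat F"
    unfolding laurent_mat_def F_def column_elimination_def
    by (auto intro!: laurent_add laurent_if laurent_const Ls Ly)
  show ?case
  proof (rule exI[of _ "\<lambda>z. R z ** F z"], rule exI[of _ D'], rule exI[of _ "\<lambda>z. s z * s z * \<rho> z"],
      intro conjI allI impI ballI)
    show "laurent_mat (\<lambda>z. R z ** F z)" by (intro laurent_mat_mult L LF)
    show "laurent_mat D'" unfolding D'_def by (intro laurent_mat_mult LE L laurent_mat_adj)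
    show "laurent (\<lambda>z. s z * s z * \<rho> z)" by (intro laurent_mult Ls L)
  next
    fix z :: complex assume z: "norm z = 1"
    note zz = *[rule_format, OF z]
    have D': "D' z = E z ** D z ** conj_transpose (E z)" by (simp add: D'_def adj_mat_fun_unit z)
    obtain x where x: "x > 0" "s z = of_real x" using pos_definite_diag[of "D z" k] zz by (auto simp: s_def)
    hence s: "s z \<noteq> 0" "cnj (s z) = s z" by auto
    have FE: "F z ** E z = (s z * s z) *\<^sub>m mat 1"
      unfolding F_def E_def by (rule column_elimination_inverse) (simp add: y_def)
    have "det (F z) * det (E z) \<noteq> 0"
      using s by (simp add: det_mul[symmetric] FE det_smult_mat)
    hence dE: "det (E z) \<noteq> 0" by auto
    show "s z * s z * \<rho> z \<noteq> 0" using s zz by simp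
    show "pos_definite (D' z)" unfolding D' using zz by (intro pos_definite_congruence dE) auto
    have "R z ** F z ** D' z ** conj_transpose (R z ** F z) =
        R z ** (F z ** E z) ** D z ** conj_transpose (F z ** E z) ** conj_transpose (R z)"
      by (simp add: D' conj_transpose_mult matrix_mul_assoc)
    also have "\<dots> = (s z * s z * (s z * s z)) *\<^sub>m (R z ** D z ** conj_transpose (R z))"
    proof -
      have [simp]: "conj_transpose (mat 1 :: complex^'m^'m) = mat 1"
        by (simp add: vec_eq_iff mat_def)
      show ?thesis by (simp add: FE s smult_mat_mult_left smult_mat_mult_right)
    qed
    finally show "R z ** F z ** D' z ** conj_transpose (R z ** F z) =
        (s z * s z * \<rho> z * cnj (s z * s z * \<rho> z)) *\<^sub>m S z"
      using zz s by (simp add: mult_ac)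
    have herm: "D z $ i $ j = cnj (D z $ j $ i)" for i j
      using zz conj_transpose_nth[of "D z" i j] by (simp add: pos_definite_def)
    fix i j assume ij: "i \<in> insert k I" "j \<noteq> i"
    \<comment> \<open>In row \<open>k\<close> the two surviving terms are
      \<open>s\<^sup>2 * D k j\<close> and \<open>s\<^sup>2 * cnj (D j k)\<close>, which cancel
      because \<open>D\<close> is Hermitian. In a row of \<open>I\<close> every term vanishes, so
      finished rows stay finished.\<close>
    have D'ij: "D' z $ i $ j = s z * (s z * D z $ i $ j - y z i * D z $ k $ j)
      - cnj (y z j) * (s z * D z $ i $ k - y z i * D z $ k $ k)"
      by (simp add: D' E_def column_elimination_mult mult_column_elimination s)
    show "D' z $ i $ j = 0"
    proof (cases "i = k")
      case True
      thus ?thesis using D'ij ij herm[of k j] s by (simp add: y_def s_def)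
    next
      case False
      hence "D z $ i $ j = 0" "D z $ i $ k = 0" "y z i = 0" using ij zz by (auto simp: y_def)
      thus ?thesis using D'ij by simp
    qed
  qed
qed

section \<open>Factorization up to a scalar denominator\<close>

text \<open>The exponent is an integer so that a zero of \<open>q\<close> at the origin can be absorbed into it.\<close>

lemma fejer_riesz_poly:
  fixes q :: "complex poly" and n :: int
  assumes "\<And>z. norm z = 1 \<Longrightarrow> \<exists>x>0. poly q z = of_real x * z powi n"
  shows "\<exists>r. \<forall>z. norm z = 1 \<longrightarrow> poly q z = poly r z * cnj (poly r z) * z powi n"
  using assms
proof (induction "degree q" arbitrary: q n rule: less_induct)
  case less
  note pos = less.prems
  have q0: "q \<noteq> 0" using pos[of 1] by auto
  have nz: "poly q z \<noteq> 0" if "norm z = 1" for z using pos[OF that] that by auto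
  show ?case
  proof (cases "degree q = 0")
    case True
    then obtain c where c: "q = [:c:]" by (metis degree_eq_zeroE)
    obtain x where x: "x > 0" "c = of_real x" using pos[of 1] c by auto
    have "c = of_real (sqrt x) * cnj (of_real (sqrt x)) * z powi n" if z: "norm z = 1" for z
    proof -
      obtain y where y: "y > 0" "c = of_real y * z powi n" using pos[OF z] c by auto
      \<comment> \<open>Comparing moduli forces \<open>z powi n = 1\<close> on the circle: a
        constant \<open>q\<close> leaves no room for a nontrivial power.\<close>
      have "norm c = y" using y z by (simp add: norm_mult norm_power_int)
      hence "y = x" using x by simp
      hence "z powi n = 1" using x y by simp
      thus ?thesis using x by (simp flip: of_real_mult)
    qed
    thus ?thesis by (intro exI[of _ "[:of_real (sqrt x):]"]) (simp add: c)
  next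
    case False
    then obtain a where a: "poly q a = 0"
      using alg_closed_imp_poly_has_root[of q] by auto
    have an: "norm a \<noteq> 1" using nz a by auto
    obtain q1 where q1: "q = [:-a, 1:] * q1" using a by (auto simp: poly_eq_0_iff_dvd dvd_def)
    show ?thesis
    proof (cases "a = 0")
      case True
      have "degree q1 < degree q" proof -
        have "q = pCons 0 q1" using q1 True by simp
        thus ?thesis using q0 by (cases "q1 = 0") auto
      qed
      moreover have "\<exists>x>0. poly q1 z = of_real x * z powi (n - 1)" if z: "norm z = 1" for z
      proof -
        have "z \<noteq> 0" using z by auto
        thus ?thesis using pos[OF z] q1 True by (auto simp: power_int_diff field_simps)
      qed
      ultimately obtain r where r: "\<And>z. norm z = 1 \<Longrightarrow> poly q1 z = poly r z * cnj (poly r z) * z powi (n - 1)"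
        using less.hyps by blast
      have "poly q z = poly r z * cnj (poly r z) * z powi n" if z: "norm z = 1" for z
      proof -
        have "z \<noteq> 0" using z by auto
        thus ?thesis using r[OF z] q1 True by (simp add: power_int_diff field_simps)
      qed
      thus ?thesis by blast
    next
      case False
      define b where "b = 1 / cnj a"
      define f where "f z = poly q z * z powi (- n)" for z
      have Lf: "laurent f" unfolding f_def by (intro laurent_mult laurent_poly laurent_powi)
      \<comment> \<open>On the circle \<open>f\<close> is real, hence equal to its adjoint there and
        so off the origin; its nonzero roots therefore come in reflected pairs \<open>a\<close>,
        \<open>b\<close>.\<close>
      have "adj_fun f b = f b"
      proof (rule laurent_eqI[OF laurent_adj[OF Lf] Lf])
        fix z :: complex assume z: "norm z = 1"
        hence "z \<noteq> 0" by auto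
        obtain x where "poly q z = of_real x * z powi n" using pos[OF z] by auto
        hence "f z = of_real x" using \<open>z \<noteq> 0\<close> by (simp add: f_def power_int_minus field_simps)
        thus "adj_fun f z = f z" using z by (simp add: adj_fun_unit)
      qed (use False in \<open>auto simp: b_def\<close>)
      hence "f b = 0" using False a by (simp add: adj_fun_def b_def f_def)
      hence "poly q b = 0" using False by (auto simp: f_def b_def)
      moreover have "a \<noteq> b"
      proof
        assume "a = b"
        hence "a * cnj a = 1" using False by (simp add: b_def field_simps)
        hence "(norm a)\<^sup>2 = 1" by (metis complex_norm_square of_real_eq_1_iff)
        thus False using an by (simp add: power2_eq_1_iff) (smt (verit) norm_ge_zero)
      qed
      ultimately have "poly q1 b = 0" using q1 by auto
      then obtain q2 where q2: "q1 = [:-b, 1:] * q2" by (auto simp: poly_eq_0_iff_dvd dvd_def)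
      \<comment> \<open>On the circle \<open>z - b\<close> equals \<open>- 1 / cnj a\<close> times
        \<open>z * cnj (z - a)\<close>. Removing the pair of roots thus removes the positive factor
        \<open>(z - a) * cnj (z - a)\<close> together with one power of \<open>z\<close>, which
        lowers \<open>n\<close> by one.\<close>
      define q3 where "q3 = smult (- 1 / cnj a) q2"
      have qz: "poly q z = (z - a) * cnj (z - a) * z * poly q3 z" if z: "norm z = 1" for z
      proof -
        have "z * cnj z = 1" using z by (metis complex_norm_square of_real_1 one_power2)
        hence *: "z * cnj (z - a) = - cnj a * (z - b)" using False by (simp add: b_def algebra_simps)
        have "(z - a) * cnj (z - a) * z * poly q3 z = (z - a) * (z * cnj (z - a)) * poly q3 z"
          by (simp add: mult_ac)
        also have "\<dots> = (z - a) * (- cnj a * (z - b)) * poly q3 z" by (simp only: *)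
        also have "\<dots> = poly q z" using False by (simp add: q3_def q1 q2 algebra_simps)
        finally show ?thesis by simp
      qed
      have q2n: "q2 \<noteq> 0" using q0 q1 q2 by auto
      have "degree q = degree q2 + 2" using q2n by (simp add: q1 q2 degree_mult_eq del: mult_pCons_left)
      hence "degree q3 < degree q" using False by (simp add: q3_def)
      moreover have "\<exists>x>0. poly q3 z = of_real x * z powi (n - 1)" if z: "norm z = 1" for z
      proof -
        have z0: "z \<noteq> 0" using z by auto
        obtain x where x: "x > 0" "poly q z = of_real x * z powi n" using pos[OF z] by auto
        have za: "z \<noteq> a" using z an by auto
        have "poly q3 z = of_real (x / (norm (z - a))\<^sup>2) * z powi (n - 1)"
        proof -
          define d where "d = (z - a) * cnj (z - a)"
          have "d \<noteq> 0" using za by (simp add: d_def)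
          moreover have "d * z * poly q3 z = of_real x * z powi n" using x(2) qz[OF z] by (simp add: d_def)
          ultimately have "poly q3 z = of_real x / d * z powi (n - 1)"
            using z0 by (simp add: power_int_diff field_simps)
          thus ?thesis unfolding of_real_divide complex_norm_square d_def .
        qed
        thus ?thesis using x(1) za by (intro exI[of _ "x / (norm (z - a))\<^sup>2"]) auto
      qed
      ultimately obtain r where r: "\<And>z. norm z = 1 \<Longrightarrow> poly q3 z = poly r z * cnj (poly r z) * z powi (n - 1)"
        using less.hyps by blast
      have "poly q z = poly ([:-a, 1:] * r) z * cnj (poly ([:-a, 1:] * r) z) * z powi n" if z: "norm z = 1" for z
      proof -
        have "z \<noteq> 0" using z by auto
        hence "z powi n = z * z powi (n - 1)" by (simp add: power_int_diff field_simps)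
        moreover have "poly ([:-a, 1:] * r) z = (z - a) * poly r z" by (simp add: algebra_simps)
        ultimately show ?thesis using r[OF z] qz[OF z] by (simp add: mult_ac del: mult_pCons_left)
      qed
      thus ?thesis by blast
    qed
  qed
qed

lemma fejer_riesz:
  assumes "laurent f" "\<And>z. norm z = 1 \<Longrightarrow> \<exists>x>0. f z = of_real x"
  obtains r where "\<And>z. norm z = 1 \<Longrightarrow> f z = poly r z * cnj (poly r z)"
proof -
  obtain n q where q: "\<And>z. z \<noteq> 0 \<Longrightarrow> f z * z ^ n = poly q z" using assms(1) by (auto simp: laurent_def)
  have "\<exists>x>0. poly q z = of_real x * z powi (int n)" if z: "norm z = 1" for z
    using assms(2)[OF z] q[of z] z by force
  then obtain r where r: "\<And>z. norm z = 1 \<Longrightarrow> poly q z = poly r z * cnj (poly r z) * z powi (int n)"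
    using fejer_riesz_poly by blast
  show ?thesis
  proof (rule that)
    fix z :: complex assume z: "norm z = 1"
    hence "z \<noteq> 0" by auto
    thus "f z = poly r z * cnj (poly r z)" using r[OF z] q[of z] by simp
  qed
qed

lemma laurent_mat_clear_denominator:
  fixes R :: "complex \<Rightarrow> complex^'n^'m"
  assumes "laurent_mat R"
  obtains K Q where "\<And>z. z \<noteq> 0 \<Longrightarrow> z ^ K *\<^sub>m R z = eval_mat Q z"
proof -
  have "\<forall>p. \<exists>n q. \<forall>z. z \<noteq> 0 \<longrightarrow> R z $ fst p $ snd p * z ^ n = poly q z"
    using assms by (simp add: laurent_mat_def laurent_def)
  then obtain n q where q: "\<And>p z. z \<noteq> 0 \<Longrightarrow> R z $ fst p $ snd p * z ^ n p = poly (q p) z"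
    by metis
  define K where "K = sum n UNIV"
  have K: "n p \<le> K" for p unfolding K_def by (rule member_le_sum) auto
  define Q where "Q = (\<chi> i j. q (i, j) * monom 1 (K - n (i, j)))"
  have "z ^ K *\<^sub>m R z = eval_mat Q z" if "z \<noteq> 0" for z
  proof -
    have "z ^ K * R z $ i $ j = poly (Q $ i $ j) z" for i j
    proof -
      have "z ^ K = z ^ n (i, j) * z ^ (K - n (i, j))" using K[of "(i, j)"] by (simp flip: power_add)
      thus ?thesis using q[OF that, of "(i, j)"] by (simp add: Q_def poly_monom mult_ac)
    qed
    thus ?thesis by (simp add: vec_eq_iff)
  qed
  thus ?thesis by (rule that)
qed

lemma unit_power_cnj: "norm z = 1 \<Longrightarrow> z ^ n * cnj z ^ n = 1"
  by (metis complex_norm_square of_real_1 one_power2 power_mult_distrib power_one)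

text \<open>The diagonal entries of \<open>D\<close> are positive on the circle, so the scalar
  theorem splits \<open>D\<close> as \<open>G\<close> times its conjugate transpose. The powers of
  \<open>z\<close> that make everything polynomial have modulus one on the circle and drop out of
  both sides.\<close>

lemma factor_with_denominator:
  fixes S :: "complex \<Rightarrow> complex^'m^'m"
  assumes "laurent_mat S" "\<And>z. norm z = 1 \<Longrightarrow> pos_definite (S z)"
  obtains R :: "complex poly^'m^'m" and \<rho> where "\<And>z. norm z = 1 \<Longrightarrow> poly \<rho> z \<noteq> 0"
    "\<And>z. norm z = 1 \<Longrightarrow>
      eval_mat R z ** conj_transpose (eval_mat R z) = (poly \<rho> z * cnj (poly \<rho> z)) *\<^sub>m S z"
proof -
  obtain R D :: "complex \<Rightarrow> complex^'m^'m" and \<rho> where L: "laurent_mat R" "laurent_mat D" "laurent \<rho>"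
    and *: "\<forall>z. norm z = 1 \<longrightarrow> \<rho> z \<noteq> 0 \<and> pos_definite (D z) \<and>
      R z ** D z ** conj_transpose (R z) = (\<rho> z * cnj (\<rho> z)) *\<^sub>m S z \<and>
      (\<forall>i\<in>UNIV. \<forall>j. j \<noteq> i \<longrightarrow> D z $ i $ j = 0)"
    using congruent_diagonal[of S UNIV] assms finite[of "UNIV :: 'm set"] by blast
  note * = *[rule_format]
  have "\<exists>r. \<forall>z. norm z = 1 \<longrightarrow> D z $ i $ i = poly r z * cnj (poly r z)" for i
  proof -
    have L: "laurent (\<lambda>z. D z $ i $ i)" using L(2) by (simp add: laurent_mat_def)
    have "\<And>z. norm z = 1 \<Longrightarrow> \<exists>x>0. D z $ i $ i = of_real x" using pos_definite_diag * by blast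
    thus ?thesis using fejer_riesz[OF L] by metis
  qed
  then obtain r where r: "\<And>i z. norm z = 1 \<Longrightarrow> D z $ i $ i = poly (r i) z * cnj (poly (r i) z)" by metis
  define G :: "complex poly^'m^'m" where "G = (\<chi> i j. if i = j then r i else 0)"
  have G: "D z = eval_mat G z ** conj_transpose (eval_mat G z)" if z: "norm z = 1" for z
  proof -
    have "D z $ i $ j = (\<Sum>k\<in>UNIV. poly (G $ i $ k) z * cnj (poly (G $ j $ k) z))" for i j
      using *[OF z] r[OF z, of i]
      by (cases "i = j") (auto simp: G_def if_distrib[of "\<lambda>q. poly q _"] if_distrib[of "\<lambda>x. x * _"] cong: if_cong)
    thus ?thesis by (simp add: vec_eq_iff matrix_matrix_mult_def)
  qed
  obtain K Q where Q: "\<And>z. z \<noteq> 0 \<Longrightarrow> z ^ K *\<^sub>m R z = eval_mat Q z"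
    using laurent_mat_clear_denominator[OF L(1)] by blast
  obtain k \<sigma> where \<sigma>: "\<And>z. z \<noteq> 0 \<Longrightarrow> \<rho> z * z ^ k = poly \<sigma> z"
    using L(3) by (auto simp: laurent_def)
  show ?thesis
  proof (rule that[of \<sigma> "Q ** G"])
    fix z :: complex assume z: "norm z = 1"
    hence z0: "z \<noteq> 0" by auto
    show "poly \<sigma> z \<noteq> 0" using *[OF z] z0 by (simp flip: \<sigma>)
    have "eval_mat (Q ** G) z ** conj_transpose (eval_mat (Q ** G) z) = 
        eval_mat Q z ** D z ** conj_transpose (eval_mat Q z)"
      by (simp add: eval_mat_mult conj_transpose_mult G[OF z] matrix_mul_assoc)
    also have "\<dots> = (z ^ K * cnj z ^ K) *\<^sub>m (R z ** D z ** conj_transpose (R z))"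
      by (simp add: smult_mat_mult_left smult_mat_mult_right mult_ac flip: Q[OF z0])
    also have "\<dots> = (\<rho> z * cnj (\<rho> z)) *\<^sub>m S z" using *[OF z] unit_power_cnj[OF z] by simp
    also have "\<rho> z * cnj (\<rho> z) = (\<rho> z * cnj (\<rho> z)) * (z ^ k * cnj z ^ k)"
      using unit_power_cnj[OF z] by simp
    also have "\<dots> = poly \<sigma> z * cnj (poly \<sigma> z)"
      by (simp add: mult_ac flip: \<sigma>[OF z0])
    finally show "eval_mat (Q ** G) z ** conj_transpose (eval_mat (Q ** G) z) =
      (poly \<sigma> z * cnj (poly \<sigma> z)) *\<^sub>m S z" .
  qed
qed

section \<open>Moving zeros across the unit circle\<close>

text \<open>For a unit vector \<open>v\<close> this is multiplication by \<open>b\<close> on the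
  line of \<open>v\<close> and the identity on its orthogonal complement.\<close>

definition rank_one_update :: "complex^'m \<Rightarrow> complex \<Rightarrow> complex^'m^'m" where
  "rank_one_update v b = (\<chi> i j. (if i = j then 1 else 0) + (b - 1) * v $ i * cnj (v $ j))"

lemma mult_rank_one_update:
  "(M ** rank_one_update v b) $ i $ j = M $ i $ j + (b - 1) * (\<Sum>l\<in>UNIV. M $ i $ l * v $ l) * cnj (v $ j)"
  by (simp add: rank_one_update_def matrix_matrix_mult_def distrib_left sum.distrib sum_distrib_left
      sum_distrib_right if_distrib[of "\<lambda>x. _ * x"] mult_ac cong: if_cong)

lemma conj_transpose_rank_one_update:
  "conj_transpose (rank_one_update v b) = rank_one_update v (cnj b)"
  by (simp add: rank_one_update_def vec_eq_iff mult_ac)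

lemma rank_one_update_one: "rank_one_update v 1 = mat 1"
  by (simp add: rank_one_update_def vec_eq_iff mat_def)

context
  fixes v :: "complex^'m"
  assumes v: "(\<Sum>i\<in>UNIV. v $ i * cnj (v $ i)) = 1"
begin

lemma rank_one_update_mult:
  "rank_one_update v b ** rank_one_update v c = rank_one_update v (b * c)"
proof -
  have "(\<Sum>l\<in>UNIV. rank_one_update v b $ i $ l * v $ l) = b * v $ i" for i
  proof -
    have "(\<Sum>l\<in>UNIV. rank_one_update v b $ i $ l * v $ l) =
        v $ i + (b - 1) * v $ i * (\<Sum>l\<in>UNIV. v $ l * cnj (v $ l))"
      by (simp add: rank_one_update_def distrib_right sum.distrib sum_distrib_left
        if_distrib[of "\<lambda>x. x * _"] cong: if_cong) (simp add: mult_ac)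
    thus ?thesis by (simp add: v algebra_simps)
  qed
  thus ?thesis
    by (simp add: vec_eq_iff mult_rank_one_update) (simp add: rank_one_update_def algebra_simps)
qed

text \<open>A change of basis: choose \<open>k\<close> with \<open>v $ k \<noteq> 0\<close> and
  replace the \<open>k\<close>-th unit vector by \<open>v\<close>, which gives \<open>C\<close>. In
  this basis the map is \<open>T\<close>, the identity except for row \<open>k\<close>, whose
  diagonal entry is \<open>b\<close>: the functional \<open>v\<^sup>*\<close> takes the value 1 on
  \<open>v\<close> and \<open>cnj (v $ j)\<close> on the other basis vectors.\<close>

lemma det_rank_one_update: "det (rank_one_update v b) = b"
proof -
  have "\<exists>k. v $ k \<noteq> 0"
  proof (rule ccontr)
    assume "\<not> ?thesis" thus False using v by simp
  qed
  then obtain k where k: "v $ k \<noteq> 0" ..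
  define C :: "complex^'m^'m" where "C = (\<chi> i j. if j = k then v $ i else if i = j then 1 else 0)"
  define w :: "complex^'m" where "w = (\<chi> j. if j = k then b else (b - 1) * cnj (v $ j))"
  define T :: "complex^'m^'m" where "T = (\<chi> i j. if i = k then w $ j else if i = j then 1 else 0)"
  have dC: "det C = v $ k"
  proof -
    have "C = (\<chi> i j. if j = k then (mat 1 *v v) $ i else mat 1 $ i $ j)"
      unfolding matrix_vector_mul_lid by (simp add: C_def vec_eq_iff mat_def)
    thus ?thesis using cramer_lemma[of k "mat 1" v] by simp
  qed
  have dT: "det T = b"
  proof -
    have "transpose T = (\<chi> i j. if j = k then (mat 1 *v w) $ i else mat 1 $ i $ j)"
      unfolding matrix_vector_mul_lid by (auto simp: T_def vec_eq_iff mat_def transpose_def)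
    hence "det (transpose T) = b" using cramer_lemma[of k "mat 1" w] by (simp add: w_def)
    thus ?thesis by simp
  qed
  have "(rank_one_update v b ** C) $ i $ j = (C ** T) $ i $ j" for i j
  proof -
    have "(rank_one_update v b ** C) $ i $ j = C $ i $ j + (b - 1) * v $ i * (\<Sum>l\<in>UNIV. cnj (v $ l) * C $ l $ j)"
      by (simp add: rank_one_update_def matrix_matrix_mult_def distrib_right sum.distrib sum_distrib_left
        if_distrib[of "\<lambda>x. x * _"] cong: if_cong) (simp add: mult_ac)
    also have "(\<Sum>l\<in>UNIV. cnj (v $ l) * C $ l $ j) = (if j = k then 1 else cnj (v $ j))"
      using v by (simp add: C_def if_distrib[of "\<lambda>x. _ * x"] mult_ac cong: if_cong)
    finally have 1: "(rank_one_update v b ** C) $ i $ j = C $ i $ j + (b - 1) * v $ i * (if j = k then 1 else cnj (v $ j))" .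
    have "T $ l $ j = (if l = j then (if j = k then 0 else 1) else 0) + (if l = k then w $ j else 0)" for l
      by (simp add: T_def)
    hence "(C ** T) $ i $ j = (if j = k then 0 else C $ i $ j) + v $ i * w $ j"
      by (simp add: matrix_matrix_mult_def distrib_left sum.distrib if_distrib[of "\<lambda>x. _ * x"] C_def cong: if_cong)
    thus ?thesis unfolding 1 by (simp add: C_def w_def algebra_simps)
  qed
  hence "rank_one_update v b ** C = C ** T" by (simp add: vec_eq_iff)
  hence "det (rank_one_update v b) * det C = det C * det T" by (metis det_mul)
  thus ?thesis using k by (simp add: dC dT)
qed

end

text \<open>The new factor is \<open>1 - cnj a * z\<close> and not a monic factor at the reflected
  point, so that \<open>a = 0\<close> is covered: there the factor is 1 and the zero simply
  disappears.\<close>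

lemma flip_zero:
  fixes R :: "complex poly^'m^'m"
  assumes "poly (det R) a = 0" "norm a \<noteq> 1"
  obtains R' where "[:-a, 1:] * det R' = [:1, -cnj a:] * det R"
    "\<And>z. norm z = 1 \<Longrightarrow>
      eval_mat R' z ** conj_transpose (eval_mat R' z) = eval_mat R z ** conj_transpose (eval_mat R z)"
proof -
  obtain x where x: "x \<noteq> 0" "eval_mat R a *v x = 0"
    using assms(1) by (metis det_eval_mat det_zero_imp_kernel)
  define v where "v = of_real (inverse (norm x)) *s x"
  have "eval_mat R a *v v = 0" using x by (simp add: v_def matrix_vector_mult_scaleR vector_scalar_commute)
  hence Rv: "(\<Sum>j\<in>UNIV. poly (R $ i $ j) a * v $ j) = 0" for i
    by (simp add: vec_eq_iff matrix_vector_mult_def)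
  have v1: "(\<Sum>i\<in>UNIV. v $ i * cnj (v $ i)) = 1"
  proof -
    have "(norm x)\<^sup>2 = (\<Sum>i\<in>UNIV. (norm (x $ i))\<^sup>2)"
      by (simp add: norm_vec_def L2_set_def sum_nonneg)
    hence "complex_of_real ((norm x)\<^sup>2) = (\<Sum>i\<in>UNIV. x $ i * cnj (x $ i))"
      by (simp only: of_real_sum complex_norm_square)
    moreover have "(\<Sum>i\<in>UNIV. v $ i * cnj (v $ i)) =
        of_real (inverse ((norm x)\<^sup>2)) * (\<Sum>i\<in>UNIV. x $ i * cnj (x $ i))"
      by (simp add: v_def sum_distrib_left power2_eq_square mult_ac)
    moreover have "complex_of_real ((norm x)\<^sup>2) \<noteq> 0" using x(1) by simp
    ultimately show ?thesis by (metis left_inverse of_real_inverse)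
  qed
  \<comment> \<open>The polynomial vector \<open>R v\<close> vanishes at \<open>a\<close>, so each
    coordinate is divisible by \<open>z - a\<close> and the pole of \<open>b\<close> cancels. The
    quotients \<open>q\<close>, with \<open>(b - 1) * (z - a) = (1 - cnj a * z) - (z - a)\<close>,
    give polynomial entries for \<open>R'\<close>.\<close>
  define w where "w i = (\<Sum>j\<in>UNIV. R $ i $ j * [:v $ j:])" for i
  have "\<forall>i. \<exists>q. w i = [:-a, 1:] * q"
  proof
    fix i
    have "poly (w i) a = 0" using Rv[of i] by (simp add: w_def poly_sum mult.commute)
    thus "\<exists>q. w i = [:-a, 1:] * q" by (simp only: poly_eq_0_iff_dvd dvd_def)
  qed
  then obtain q where q: "\<And>i. w i = [:-a, 1:] * q i" by metis
  define R' where "R' = (\<chi> i j. R $ i $ j + ([:1, -cnj a:] - [:-a, 1:]) * q i * [:cnj (v $ j):])"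
  have R': "eval_mat R' z = eval_mat R z ** rank_one_update v ((1 - cnj a * z) / (z - a))" if "z \<noteq> a" for z
  proof -
    define b where "b = (1 - cnj a * z) / (z - a)"
    have b: "(b - 1) * (z - a) = (1 - cnj a * z) - (z - a)"
    proof -
      have "b * (z - a) = 1 - cnj a * z" using that by (simp add: b_def)
      thus ?thesis by (simp only: left_diff_distrib[of b]) simp
    qed
    have "poly (w i) z = (\<Sum>l\<in>UNIV. poly (R $ i $ l) z * v $ l)" for i
      by (simp add: w_def poly_sum mult.commute)
    moreover have "poly (w i) z = (z - a) * poly (q i) z" for i
      by (simp add: q algebra_simps)
    ultimately have E: "(b - 1) * (\<Sum>l\<in>UNIV. poly (R $ i $ l) z * v $ l) = ((1 - cnj a * z) - (z - a)) * poly (q i) z" for i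
      by (metis b mult.assoc)
    have "poly (R' $ i $ j) z = poly (R $ i $ j) z + ((1 - cnj a * z) - (z - a)) * poly (q i) z * cnj (v $ j)" for i j
      by (simp add: R'_def algebra_simps)
    thus ?thesis
      unfolding b_def[symmetric] vec_eq_iff mult_rank_one_update eval_mat_nth E by simp
  qed
  show ?thesis
  proof (rule that[of R'])
    have "infinite (UNIV - {a} :: complex set)" by (simp add: infinite_UNIV_char_0)
    thus "[:-a, 1:] * det R' = [:1, -cnj a:] * det R"
    proof (rule poly_eqI_infinite)
      fix z assume "z \<in> UNIV - {a}"
      hence z: "z \<noteq> a" by simp
      have "poly (det R') z = poly (det R) z * ((1 - cnj a * z) / (z - a))"
        by (simp add: R'[OF z] det_mul det_rank_one_update[OF v1] flip: det_eval_mat)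
      hence "(z - a) * poly (det R') z = (1 - cnj a * z) * poly (det R) z" using z by simp
      thus "poly ([:-a, 1:] * det R') z = poly ([:1, -cnj a:] * det R) z" by (simp add: algebra_simps)
    qed
  next
    fix z :: complex assume z: "norm z = 1"
    hence za: "z \<noteq> a" using assms(2) by auto
    define b where "b = (1 - cnj a * z) / (z - a)"
    have zz: "z * cnj z = 1" using unit_power_cnj[OF z, of 1] by simp
    have "1 - cnj a * z = z * cnj (z - a)" using zz by (simp add: algebra_simps)
    hence "norm (1 - cnj a * z) = norm (z - a)" using z by (simp add: norm_mult del: complex_cnj_diff)
    hence "norm b = 1" using za by (simp add: b_def norm_divide)
    hence "b * cnj b = 1" using unit_power_cnj[of b 1] by simp
    hence W: "rank_one_update v b ** conj_transpose (rank_one_update v b) = mat 1"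
      by (simp add: conj_transpose_rank_one_update rank_one_update_mult[OF v1] rank_one_update_one)
    have "eval_mat R' z ** conj_transpose (eval_mat R' z) =
        eval_mat R z ** (rank_one_update v b ** conj_transpose (rank_one_update v b)) ** conj_transpose (eval_mat R z)"
      by (simp add: R'[OF za] b_def[symmetric] conj_transpose_mult matrix_mul_assoc)
    thus "eval_mat R' z ** conj_transpose (eval_mat R' z) = eval_mat R z ** conj_transpose (eval_mat R z)"
      by (simp add: W)
  qed
qed

text \<open>The condition on \<open>A\<close> says that no point of \<open>A\<close> is the
  reflection of a point of \<open>A\<close>, itself included, so \<open>A\<close> avoids the circle
  and a flip never creates a zero inside \<open>A\<close>. The total multiplicity in
  \<open>A\<close> then drops with each flip. Written as a product, the condition allows
  \<open>A\<close> to contain 0.\<close>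

lemma flip_zeros:
  fixes R :: "complex poly^'m^'m"
  assumes "finite A" "\<And>a b. a \<in> A \<Longrightarrow> b \<in> A \<Longrightarrow> b * cnj a \<noteq> 1" "det R \<noteq> 0"
  shows "\<exists>R'. (\<forall>a\<in>A. poly (det R') a \<noteq> 0) \<and> (\<forall>z. norm z = 1 \<longrightarrow>
      eval_mat R' z ** conj_transpose (eval_mat R' z) = eval_mat R z ** conj_transpose (eval_mat R z))"
  using assms(3)
proof (induction "\<Sum>a\<in>A. order a (det R)" arbitrary: R rule: less_induct)
  case less
  show ?case
  proof (cases "\<exists>a\<in>A. poly (det R) a = 0")
    case False
    thus ?thesis by blast
  next
    case True
    then obtain a where a: "a \<in> A" "poly (det R) a = 0" by blast
    have "norm a \<noteq> 1" using assms(2)[OF a(1) a(1)] unit_power_cnj[of a 1] by auto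
    then obtain R' where R': "[:-a, 1:] * det R' = [:1, -cnj a:] * det R"
      "\<And>z. norm z = 1 \<Longrightarrow>
        eval_mat R' z ** conj_transpose (eval_mat R' z) = eval_mat R z ** conj_transpose (eval_mat R z)"
      using flip_zero[OF a(2)] by blast
    have nz: "[:-a, 1:] * det R' \<noteq> 0" unfolding R'(1) using less.prems by (simp del: mult_pCons_left)
    hence R'0: "det R' \<noteq> 0" by auto
    have ord: "order c (det R) = order c (det R') + order c [:-a, 1:]" if c: "c \<in> A" for c
    proof -
      have "order c [:1, -cnj a:] = 0" using assms(2)[OF a(1) c] by (intro order_0I) (simp add: mult.commute)
      hence "order c ([:1, -cnj a:] * det R) = order c (det R)"
        using order_mult[OF nz[unfolded R'(1)]] by (simp only: add_0)
      moreover have "order c ([:-a, 1:] * det R') = order c [:-a, 1:] + order c (det R')"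
        using nz by (rule order_mult)
      ultimately show ?thesis using R'(1) by simp
    qed
    have "(\<Sum>c\<in>A. order c (det R')) < (\<Sum>c\<in>A. order c (det R))"
    proof (rule sum_strict_mono_ex1[OF assms(1)])
      show "\<forall>c\<in>A. order c (det R') \<le> order c (det R)" using ord by simp
      have "order a [:-a, 1:] \<noteq> 0" using order_root[of "[:-a, 1:]" a] by simp
      thus "\<exists>c\<in>A. order c (det R') < order c (det R)" using ord[OF a(1)] by (intro bexI[OF _ a(1)]) simp
    qed
    from less.hyps[OF this R'0] show ?thesis using R'(2) by metis
  qed
qed

text \<open>One root of \<open>\<rho>\<close> is removed at a time. What can be divided out of the
  matrix is not the factor at \<open>a\<close> but the one at the reflected point, which has the
  same modulus on the circle after scaling.\<close>

lemma remove_denominator: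
  fixes S :: "complex \<Rightarrow> complex^'m^'m" and R :: "complex poly^'m^'m"
  assumes S: "laurent_mat S"
    and "\<And>z. norm z = 1 \<Longrightarrow> det (S z) \<noteq> 0"
    and "\<And>z. norm z = 1 \<Longrightarrow> poly \<rho> z \<noteq> 0"
    and "\<And>z. norm z = 1 \<Longrightarrow>
      eval_mat R z ** conj_transpose (eval_mat R z) = (poly \<rho> z * cnj (poly \<rho> z)) *\<^sub>m S z"
  shows "\<exists>P :: complex poly^'m^'m. \<forall>z. norm z = 1 \<longrightarrow>
      eval_mat P z ** conj_transpose (eval_mat P z) = S z"
  using assms(3,4)
proof (induction "degree \<rho>" arbitrary: \<rho> R rule: less_induct)
  case less
  note nz = less.prems(1) and RR = less.prems(2)
  have \<rho>0: "\<rho> \<noteq> 0" using nz[of 1] by auto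
  show ?case
  proof (cases "degree \<rho> = 0")
    case True
    then obtain c where c: "\<rho> = [:c:]" by (metis degree_eq_zeroE)
    have "c \<noteq> 0" using c \<rho>0 by simp
    have "eval_mat ([:inverse c:] *\<^sub>m R) z ** conj_transpose (eval_mat ([:inverse c:] *\<^sub>m R) z) = S z"
      if z: "norm z = 1" for z
      using RR[OF z] \<open>c \<noteq> 0\<close> by (simp add: c smult_mat_mult_left smult_mat_mult_right field_simps)
    thus ?thesis by blast
  next
    case False
    then obtain a where a: "poly \<rho> a = 0" using alg_closed_imp_poly_has_root[of \<rho>] by auto
    obtain \<sigma> where \<sigma>: "\<rho> = [:-a, 1:] * \<sigma>" using a by (auto simp: poly_eq_0_iff_dvd dvd_def)
    have deg: "degree \<sigma> < degree \<rho>"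
      using \<rho>0 by (cases "\<sigma> = 0") (auto simp: \<sigma> degree_mult_eq simp del: mult_pCons_left)
    have \<sigma>nz: "poly \<sigma> z \<noteq> 0" if "norm z = 1" for z using nz[OF that] by (auto simp: \<sigma>)
    have \<rho>z: "poly \<rho> z = (z - a) * poly \<sigma> z" for z by (simp add: \<sigma> algebra_simps)
    have an: "norm a \<noteq> 1" using nz a by auto
    show ?thesis
    proof (cases "a = 0")
      case True
      have "eval_mat R z ** conj_transpose (eval_mat R z) = (poly \<sigma> z * cnj (poly \<sigma> z)) *\<^sub>m S z"
        if z: "norm z = 1" for z
      proof -
        have "poly \<rho> z * cnj (poly \<rho> z) = (z * cnj z) * (poly \<sigma> z * cnj (poly \<sigma> z))"
          by (simp add: \<rho>z True)
        thus ?thesis using RR[OF z] unit_power_cnj[OF z, of 1] by simp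
      qed
      thus ?thesis using less.hyps[OF deg] \<sigma>nz by blast
    next
      case False
      have "det (eval_mat R 1) \<noteq> 0"
      proof
        assume "det (eval_mat R 1) = 0"
        hence "det (eval_mat R 1 ** conj_transpose (eval_mat R 1)) = 0" by (simp add: det_mul)
        thus False using RR[of 1] nz[of 1] assms(2)[of 1] by (simp add: det_smult_mat)
      qed
      hence "det R \<noteq> 0" by (auto simp: det_eval_mat)
      moreover have "b * cnj c \<noteq> 1" if "c \<in> {a}" "b \<in> {a}" for b c
      proof
        assume "b * cnj c = 1"
        hence "(norm a)\<^sup>2 = 1" using that by (metis complex_norm_square of_real_eq_1_iff singletonD)
        thus False using an by (simp add: power2_eq_1_iff) (smt (verit) norm_ge_zero)
      qed
      ultimately obtain R' :: "complex poly^'m^'m" where R': "poly (det R') a \<noteq> 0"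
        "\<And>z. norm z = 1 \<Longrightarrow>
          eval_mat R' z ** conj_transpose (eval_mat R' z) = eval_mat R z ** conj_transpose (eval_mat R z)"
        using flip_zeros[of "{a}" R] by auto
      \<comment> \<open>\<open>R'(a)\<close> is invertible, so the whole matrix \<open>R'\<close> vanishes at the reflected point and a linear
        factor can be cancelled.\<close>
      define b where "b = 1 / cnj a"
      have "eval_mat R' a ** adj_mat_fun (eval_mat R') a = (poly \<rho> a * adj_fun (poly \<rho>) a) *\<^sub>m S a"
      proof (rule laurent_mat_eqI)
        show "laurent_mat (\<lambda>z. eval_mat R' z ** adj_mat_fun (eval_mat R') z)"
          by (intro laurent_mat_mult laurent_mat_adj laurent_mat_eval)
        show "laurent_mat (\<lambda>z. (poly \<rho> z * adj_fun (poly \<rho>) z) *\<^sub>m S z)"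
          by (intro laurent_smult_mat laurent_mult laurent_adj laurent_poly S)
      qed (use RR R'(2) False in \<open>auto simp: adj_fun_unit adj_mat_fun_unit\<close>)
      hence "eval_mat R' a ** conj_transpose (eval_mat R' b) = 0"
        by (simp add: a adj_mat_fun_def b_def vec_eq_iff)
      moreover obtain B where "B ** eval_mat R' a = mat 1"
        using R'(1) invertible_det_nz[of "eval_mat R' a"] by (auto simp: det_eval_mat invertible_def)
      ultimately have "conj_transpose (eval_mat R' b) = 0"
        by (metis matrix_mul_assoc matrix_mul_lid times0_right)
      hence "eval_mat R' b = 0" by (simp add: vec_eq_iff)
      hence "[:-b, 1:] dvd R' $ i $ j" for i j
        by (simp add: vec_eq_iff flip: poly_eq_0_iff_dvd)
      define q where "q i j = R' $ i $ j div [:-b, 1:]" for i j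
      have q: "R' $ i $ j = [:-b, 1:] * q i j" for i j
        unfolding q_def by (rule dvd_mult_div_cancel[symmetric]) fact
      \<comment> \<open>The constant normalizes the cancelled factor to
        \<open>d = cnj a * (z - b)\<close>, for which
        \<open>d * cnj d = (z - a) * cnj (z - a)\<close> on the circle.\<close>
      define R2 where "R2 = (\<chi> i j. [:1 / cnj a:] * q i j)"
      have "eval_mat R2 z ** conj_transpose (eval_mat R2 z) = (poly \<sigma> z * cnj (poly \<sigma> z)) *\<^sub>m S z"
        if z: "norm z = 1" for z
      proof -
        define d where "d = cnj a * (z - b)"
        have zz: "z * cnj z = 1" using unit_power_cnj[OF z, of 1] by simp
        have d: "d = - (z * cnj (z - a))" using zz False by (simp add: d_def b_def algebra_simps)
        have d0: "d \<noteq> 0" using an z d by auto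
        have "d * cnj d = (z * cnj z) * ((z - a) * cnj (z - a))" unfolding d by (simp add: mult_ac)
        hence dd: "d * cnj d = (z - a) * cnj (z - a)" using zz by simp
        have "eval_mat R' z = d *\<^sub>m eval_mat R2 z"
          using False by (simp add: vec_eq_iff q R2_def d_def algebra_simps)
        hence "(d * cnj d) *\<^sub>m (eval_mat R2 z ** conj_transpose (eval_mat R2 z)) =
            eval_mat R z ** conj_transpose (eval_mat R z)"
          using R'(2)[OF z] by (simp add: smult_mat_mult_left smult_mat_mult_right mult_ac)
        also have "\<dots> = (d * cnj d) *\<^sub>m (poly \<sigma> z * cnj (poly \<sigma> z)) *\<^sub>m S z"
          unfolding dd RR[OF z] by (simp add: \<rho>z mult_ac)
        finally have "inverse (d * cnj d) *\<^sub>m (d * cnj d) *\<^sub>m (eval_mat R2 z ** conj_transpose (eval_mat R2 z)) =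
            inverse (d * cnj d) *\<^sub>m (d * cnj d) *\<^sub>m (poly \<sigma> z * cnj (poly \<sigma> z)) *\<^sub>m S z" by simp
        moreover have "inverse (d * cnj d) * (d * cnj d) = 1" using d0 by (intro left_inverse) simp
        ultimately show ?thesis
          by (metis (no_types, lifting) smult_mat_one smult_mat_smult_mat)
      qed
      thus ?thesis using less.hyps[OF deg] \<sigma>nz by blast
    qed
  qed
qed

section \<open>Existence and uniqueness of the spectral factor\<close>

text \<open>Simplicity is phrased through cofactors so that it passes to \<open>p1\<close>: a
  cofactor of \<open>p1\<close> times \<open>z - a\<close> is a cofactor of \<open>p\<close>. A root
  of \<open>p1\<close> differs from \<open>a\<close>, so it remains a root of \<open>u\<close> after
  division by \<open>z - a\<close>.\<close>

lemma simple_roots_dvd: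
  fixes p u :: "complex poly"
  assumes "p \<noteq> 0" "\<And>a q. p = [:-a, 1:] * q \<Longrightarrow> poly q a \<noteq> 0" "\<And>a. poly p a = 0 \<Longrightarrow> poly u a = 0"
  shows "p dvd u"
  using assms
proof (induction "degree p" arbitrary: p u rule: less_induct)
  case less
  show ?case
  proof (cases "degree p = 0")
    case True
    thus ?thesis using less.prems(1) by (simp add: is_unit_iff_degree unit_imp_dvd)
  next
    case False
    then obtain a where a: "poly p a = 0" using alg_closed_imp_poly_has_root[of p] by auto
    obtain p1 where p1: "p = [:-a, 1:] * p1" using a by (auto simp: poly_eq_0_iff_dvd dvd_def)
    obtain u1 where u1: "u = [:-a, 1:] * u1"
      using less.prems(3)[OF a] by (auto simp: poly_eq_0_iff_dvd dvd_def)
    have p1a: "poly p1 a \<noteq> 0" using less.prems(2)[OF p1] .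
    have p10: "p1 \<noteq> 0" using p1a by auto
    have "p1 dvd u1"
    proof (rule less.hyps)
      show "degree p1 < degree p" using p10 by (simp add: p1 degree_mult_eq del: mult_pCons_left)
      show "p1 \<noteq> 0" by fact
    next
      fix b q assume "p1 = [:-b, 1:] * q"
      hence "p = [:-b, 1:] * ([:-a, 1:] * q)" unfolding p1 by (simp only: mult.left_commute)
      from less.prems(2)[OF this] show "poly q b \<noteq> 0" by auto
    next
      fix b assume b: "poly p1 b = 0"
      hence "poly u b = 0" by (intro less.prems(3)) (simp add: p1)
      moreover have "poly u b = (b - a) * poly u1 b" by (simp add: u1 algebra_simps)
      ultimately show "poly u1 b = 0" using b p1a by auto
    qed
    thus ?thesis unfolding p1 u1 by (rule mult_dvd_mono[OF dvd_refl])
  qed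
qed

section \<open>Positive definiteness at every point of the circle\<close>

lemma AE_continuous_nonneg:
  fixes f :: "real \<Rightarrow> real"
  assumes "continuous_on UNIV f" "AE t in lebesgue_on {a..b}. f t \<ge> 0" "a < b" "t \<in> {a..b}"
  shows "f t \<ge> 0"
proof -
  have "AE t in lebesgue. t \<in> {a..b} \<longrightarrow> f t \<ge> 0"
    using assms(2) by (subst (asm) AE_restrict_space_iff) auto
  then obtain N where N: "negligible N" "{t. \<not> (t \<in> {a..b} \<longrightarrow> f t \<ge> 0)} \<subseteq> N"
    unfolding eventually_ae_filter_negligible by blast
  \<comment> \<open>A null set contains no nonempty open set; the open interval is taken to make
    \<open>U\<close> open, and the end points follow by closure.\<close>
  define U where "U = {a<..<b} \<inter> {t. f t < 0}"
  have "open {t. f t < 0}" using assms(1) by (intro open_Collect_less continuous_on_const)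
  hence "open U" unfolding U_def by (intro open_Int open_greaterThanLessThan)
  moreover have "negligible U" by (rule negligible_subset[OF N(1)]) (use N(2) in \<open>auto simp: U_def\<close>)
  ultimately have "U = {}" using open_not_negligible by blast
  hence pos: "f t \<ge> 0" if "t \<in> {a<..<b}" for t using that by (force simp: U_def)
  have cl: "closure {a<..<b} = {a..b}" using assms(3) by simp
  show ?thesis
    by (rule continuous_ge_on_closure[of "{a<..<b}" f])
      (use assms pos cl in \<open>auto intro: continuous_on_subset\<close>)
qed

lemma hermitian_inner_diff_scale:
  "hermitian_inner (x - c *s y) (u - d *s w) =
    hermitian_inner x u - d * hermitian_inner x w - cnj c * hermitian_inner y u + cnj c * d * hermitian_inner y w"
  by (simp add: hermitian_inner_def algebra_simps sum.distrib sum_subtractf sum_distrib_left)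

lemma hermitian_inner_self_pos:
  assumes "x \<noteq> 0" shows "Re (hermitian_inner x x) > 0"
proof -
  have "Re (hermitian_inner x x) = (\<Sum>i\<in>UNIV. (norm (x $ i))\<^sup>2)"
    by (simp only: hermitian_inner_def cmod_power2) (simp add: power2_eq_square)
  also have "\<dots> > 0"
  proof -
    obtain i where "x $ i \<noteq> 0" using assms by (auto simp: vec_eq_iff)
    thus ?thesis by (intro sum_pos2[of _ i]) auto
  qed
  finally show ?thesis .
qed

text \<open>If the form vanished at \<open>x \<noteq> 0\<close>, then \<open>A *v x\<close> would be
  nonzero, and a small step from \<open>x\<close> against it would make the form negative.\<close>

lemma pos_definite_if_nonneg_nonsingular:
  assumes "conj_transpose A = A" "\<And>x. Re (hermitian_inner x (A *v x)) \<ge> 0" "det A \<noteq> 0"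
  shows "pos_definite A"
  unfolding pos_definite_def
proof (intro conjI allI impI)
  fix x :: "complex^'a" assume "x \<noteq> 0"
  show "Re (hermitian_inner x (A *v x)) > 0"
  proof (rule ccontr)
    assume "\<not> ?thesis"
    hence Q0: "Re (hermitian_inner x (A *v x)) = 0" using assms(2)[of x] by simp
    define y where "y = A *v x"
    have "y \<noteq> 0" using kernel_imp_det_zero[OF \<open>x \<noteq> 0\<close>, of A] assms(3) by (auto simp: y_def)
    define n where "n = Re (hermitian_inner y y)"
    define q where "q = Re (hermitian_inner y (A *v y))"
    \<comment> \<open>The form at \<open>x - e y\<close> is \<open>e * (e * q - 2 * n)\<close>. This
      \<open>e\<close> ensures \<open>e * q \<le> n\<close>; the 1 in the denominator covers
      \<open>q = 0\<close>.\<close>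
    define e where "e = n / (q + 1)"
    have n: "n > 0" unfolding n_def by (rule hermitian_inner_self_pos) fact
    have q: "q \<ge> 0" unfolding q_def by (rule assms(2))
    have xy: "hermitian_inner x (A *v y) = hermitian_inner y y"
      by (simp add: hermitian_inner_adjoint assms(1) y_def)
    have Ax: "A *v (x - of_real e *s y) = y - of_real e *s (A *v y)"
      by (simp add: matrix_vector_mult_diff_distrib y_def vector_scalar_commute)
    have "0 \<le> Re (hermitian_inner (x - of_real e *s y) (A *v (x - of_real e *s y)))" by (rule assms(2))
    also have "\<dots> = - 2 * e * n + e * e * q"
      unfolding Ax hermitian_inner_diff_scale xy using Q0 by (simp add: n_def q_def y_def)
    finally have "0 \<le> e * (e * q - 2 * n)" by (simp add: algebra_simps)
    moreover have "e > 0" using n q by (simp add: e_def)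
    moreover have "e * q \<le> n" using n q by (simp add: e_def field_simps)
    ultimately show False using n by (simp add: zero_le_mult_iff)
  qed
qed fact

text \<open>Equalities and weak inequalities survive the passage from almost everywhere to
  everywhere by continuity, strict ones do not; nonsingularity of \<open>S z\<close> restores
  strictness.\<close>

lemma pos_definite_unit_circle:
  fixes S :: "complex \<Rightarrow> complex^'m^'m"
  assumes S: "laurent_mat S"
    and AE: "AE t in lebesgue_on {0..2 * pi}. pos_definite (S (cis t))"
    and z: "norm z = 1" and det: "det (S z) \<noteq> 0"
  shows "pos_definite (S z)"
proof -
  have cont: "continuous_on UNIV (\<lambda>t. S (cis t) $ i $ j)" for i j
  proof -
    have "continuous_on (- {0}) (\<lambda>z. S z $ i $ j)"
      using S by (intro laurent_continuous) (simp add: laurent_mat_def)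
    moreover have "continuous_on UNIV cis" by (intro continuous_intros)
    moreover have "cis ` UNIV \<subseteq> - {0}" by auto
    ultimately show ?thesis using continuous_on_compose2 by blast
  qed
  obtain t where t: "t \<in> {0..2 * pi}" "z = cis t"
    using z Arg2pi_eq[of z] Arg2pi_ge_0[of z] Arg2pi_lt_2pi[of z]
    by (auto simp: cis_conv_exp intro!: that[of "Arg2pi z"])
  show ?thesis
  proof (rule pos_definite_if_nonneg_nonsingular)
    show "conj_transpose (S z) = S z"
    proof -
      have "S z $ i $ j = cnj (S z $ j $ i)" for i j
      proof -
        \<comment> \<open>Hermitian symmetry is an equation; stated as nonnegativity of minus a norm
          it falls under \<open>AE_continuous_nonneg\<close>.\<close>
        have "- norm (S (cis t) $ i $ j - cnj (S (cis t) $ j $ i)) \<ge> 0"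
        proof (rule AE_continuous_nonneg[OF _ _ _ t(1)])
          show "continuous_on UNIV (\<lambda>t. - norm (S (cis t) $ i $ j - cnj (S (cis t) $ j $ i)))"
            by (intro continuous_intros cont)
          show "AE t in lebesgue_on {0..2 * pi}. - norm (S (cis t) $ i $ j - cnj (S (cis t) $ j $ i)) \<ge> 0"
            using AE
          proof (rule eventually_mono)
            fix t assume "pos_definite (S (cis t))"
            hence "S (cis t) $ i $ j = cnj (S (cis t) $ j $ i)"
              using conj_transpose_nth[of "S (cis t)" i j] by (simp add: pos_definite_def)
            thus "- norm (S (cis t) $ i $ j - cnj (S (cis t) $ j $ i)) \<ge> 0" by simp
          qed
        qed simp
        thus ?thesis using t by simp
      qed
      thus ?thesis unfolding vec_eq_iff conj_transpose_nth by metis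
    qed
  next
    fix x
    have "Re (hermitian_inner x (S (cis t) *v x)) \<ge> 0"
    proof (rule AE_continuous_nonneg[OF _ _ _ t(1)])
      show "continuous_on UNIV (\<lambda>t. Re (hermitian_inner x (S (cis t) *v x)))"
        unfolding hermitian_inner_def matrix_vector_mult_def vec_lambda_beta
        by (intro continuous_on_Re continuous_on_sum continuous_on_mult continuous_on_const cont)
      show "AE t in lebesgue_on {0..2 * pi}. Re (hermitian_inner x (S (cis t) *v x)) \<ge> 0"
        using AE
      proof (rule eventually_mono)
        fix t assume "pos_definite (S (cis t))"
        thus "Re (hermitian_inner x (S (cis t) *v x)) \<ge> 0"
          by (cases "x = 0") (auto simp: pos_definite_def less_imp_le hermitian_inner_def)
      qed
    qed simp
    thus "Re (hermitian_inner x (S z *v x)) \<ge> 0" using t by simp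
  qed (rule det)
qed

section \<open>Zeros of a scalar spectral factor\<close>

text \<open>The leading coefficient of \<open>f\<close> is the product of \<open>coeff p L\<close> and \<open>cnj (coeff p 0)\<close>.\<close>

lemma laurent_spectral_factor_at_zero:
  assumes f: "laurent_polynomial_of_degree L f" and deg: "degree p \<le> L"
    and pf: "\<And>z. z \<noteq> 0 \<Longrightarrow> poly p z * adj_fun (poly p) z = f z"
  shows "poly p 0 \<noteq> 0"
proof
  assume p0: "poly p 0 = 0"
  obtain c :: "int \<Rightarrow> complex" where c: "c (int L) \<noteq> 0"
    "\<And>z. z \<noteq> 0 \<Longrightarrow> f z = (\<Sum>n = - int L..int L. c n * z powi n)"
    using f by (auto simp: laurent_polynomial_of_degree_def)
  \<comment> \<open>\<open>q\<close> is \<open>z ^ L\<close> times \<open>f\<close>, and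
    \<open>r\<close> is \<open>z ^ L\<close> times the adjoint of \<open>p\<close>. Both
    \<open>p\<close> and \<open>r\<close> have degree at most \<open>L\<close>, so coefficient
    \<open>2 * L\<close> of the product comes from \<open>coeff p L * coeff r L\<close> alone, and
    \<open>coeff r L\<close> is the conjugate of \<open>coeff p 0\<close>.\<close>
  define q where "q = (\<Sum>n = - int L..int L. monom (c n) (nat (n + int L)))"
  define r where "r = monom 1 (L - degree p) * reflect_poly (map_poly cnj p)"
  have degc: "degree (map_poly cnj p) = degree p" by (rule degree_map_poly) auto
  have "infinite (UNIV - {0} :: complex set)" by (simp add: infinite_UNIV_char_0)
  hence "p * r = q"
  proof (rule poly_eqI_infinite)
    fix z :: complex assume "z \<in> UNIV - {0}"
    hence z: "z \<noteq> 0" by simp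
    have "poly q z = (\<Sum>n = - int L..int L. c n * z powi n * z ^ L)"
      unfolding q_def poly_sum
    proof (rule sum.cong[OF refl])
      fix n assume "n \<in> {- int L..int L}"
      hence "z powi (n + int L) = z ^ nat (n + int L)" by (simp add: power_int_def)
      hence "z powi n * z ^ L = z ^ nat (n + int L)" using z by (simp add: power_int_add)
      thus "poly (monom (c n) (nat (n + int L))) z = c n * z powi n * z ^ L"
        by (simp add: poly_monom)
    qed
    also have "\<dots> = f z * z ^ L" using c(2)[OF z] by (simp add: sum_distrib_right)
    also have "\<dots> = poly (p * r) z"
    proof -
      have "z ^ L = z ^ degree p * z ^ (L - degree p)" using deg by (simp flip: power_add)
      thus ?thesis
        by (simp add: r_def poly_reflect_cnj[OF z] poly_monom adj_fun_def flip: pf[OF z])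
    qed
    finally show "poly (p * r) z = poly q z" by simp
  qed
  moreover have "coeff q (2 * L) = c (int L)"
  proof -
    have "coeff q (2 * L) = (\<Sum>n = - int L..int L. if n = int L then c n else 0)"
      unfolding q_def coeff_sum by (intro sum.cong) (auto simp: coeff_monom)
    thus ?thesis by simp
  qed
  moreover have "coeff (p * r) (2 * L) = 0"
    unfolding coeff_mult
  proof (rule sum.neutral, rule ballI)
    fix i assume i: "i \<in> {..2 * L}"
    have rL: "coeff r L = 0"
      using p0 deg by (simp add: r_def coeff_monom_mult coeff_reflect_poly degc coeff_map_poly poly_0_coeff_0)
    have degr: "degree r \<le> L"
    proof -
      have "degree r \<le> degree (reflect_poly (map_poly cnj p)) + (L - degree p)"
        unfolding r_def using degree_mult_le degree_monom_le by (metis add.commute add_left_mono order_trans)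
      thus ?thesis using degree_reflect_poly_le[of "map_poly cnj p"] degc deg by linarith
    qed
    show "coeff p i * coeff r (2 * L - i) = 0"
    proof (cases i L rule: linorder_cases)
      case less thus ?thesis using degr by (simp add: coeff_eq_0)
    next
      case equal thus ?thesis using rL by simp
    next
      case greater thus ?thesis using deg by (simp add: coeff_eq_0)
    qed
  qed
  ultimately show False using c(1) by simp
qed

text \<open>If either conclusion failed, the product in \<open>pf\<close> would vanish at \<open>a\<close> to order at least two.\<close>

lemma simple_spectral_factor:
  assumes pf: "\<And>z. z \<noteq> 0 \<Longrightarrow> poly p z * adj_fun (poly p) z = f z"
    and simple: "\<And>a. a \<noteq> 0 \<Longrightarrow> f a = 0 \<Longrightarrow> zorder f a = 1"
    and p0: "poly p 0 \<noteq> 0" and q: "p = [:-a, 1:] * q"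
  shows "poly q a \<noteq> 0" "poly p (1 / cnj a) \<noteq> 0"
proof -
  have pa: "poly p a = 0" by (simp add: q)
  have a: "a \<noteq> 0" using pa p0 by auto
  \<comment> \<open>The largest disc around \<open>a\<close> that avoids the origin, where the
    adjoint may have a pole.\<close>
  define U where "U = ball a (norm a)"
  have U0: "z \<noteq> 0" if "z \<in> U" for z using that by (auto simp: U_def dist_norm)
  have "p \<noteq> 0" using p0 by auto
  define r where "r = reflect_poly (map_poly cnj p)"
  have adj: "adj_fun (poly p) z = poly r z / z ^ degree p" if "z \<noteq> 0" for z
    using poly_reflect_cnj[OF that, of p] that by (simp add: r_def adj_fun_def)
  have "(\<lambda>z. poly r z / z ^ degree p) holomorphic_on U"
    using U0 by (intro holomorphic_intros) auto
  hence adjh: "adj_fun (poly p) holomorphic_on U"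
    by (rule holomorphic_transform) (use U0 adj in auto)
  have "(\<lambda>z. poly p z * adj_fun (poly p) z) holomorphic_on U"
    by (intro holomorphic_intros adjh)
  hence fh: "f holomorphic_on U" by (rule holomorphic_transform) (use U0 pf in auto)
  have "\<exists>w\<in>U. f w \<noteq> 0"
  proof (rule ccontr)
    assume "\<not> ?thesis"
    hence "poly (p * r) w = 0" if "w \<in> U" for w
      using pf[of w] adj[of w] U0[OF that] that by auto
    hence "U \<subseteq> {w. poly (p * r) w = 0}" by blast
    moreover have "infinite U" unfolding U_def using a finite_imp_not_open[of "ball a (norm a)"] by auto
    moreover have "p * r \<noteq> 0" using \<open>p \<noteq> 0\<close> by (simp add: r_def map_poly_eq_0_iff)
    ultimately show False using poly_roots_finite[of "p * r"] finite_subset by metis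
  qed
  moreover have fa: "f a = 0" using pf[OF a] pa by simp
  ultimately obtain s where s: "s > 0" "cball a s \<subseteq> U" "zor_poly f a holomorphic_on cball a s"
    "\<And>w. w \<in> cball a s \<Longrightarrow> f w = zor_poly f a w * (w - a) ^ nat (zorder f a) \<and> zor_poly f a w \<noteq> 0"
    using zorder_exist_zero[OF fh, of a] a by (auto simp: U_def)
  \<comment> \<open>The order of \<open>f\<close> at \<open>a\<close> is 1, so one factor
    \<open>w - a\<close> cancels from both sides. In the limit the product of
    \<open>poly q a\<close> and the adjoint of \<open>p\<close> at \<open>a\<close> equals
    \<open>zor_poly f a a\<close>, which is nonzero; both conclusions are read off from this
    product.\<close>
  have ev: "eventually (\<lambda>w. poly q w * adj_fun (poly p) w = zor_poly f a w) (at a)"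
    unfolding eventually_at
  proof (intro exI[of _ s] conjI ballI impI s(1))
    fix w assume w: "w \<noteq> a \<and> dist w a < s"
    hence wc: "w \<in> cball a s" by (simp add: dist_commute)
    hence "w \<noteq> 0" using U0[OF subsetD[OF s(2)]] by blast
    have "(w - a) * (poly q w * adj_fun (poly p) w) = poly p w * adj_fun (poly p) w"
      by (simp add: q algebra_simps)
    also have "\<dots> = (w - a) * zor_poly f a w"
      using pf[OF \<open>w \<noteq> 0\<close>] s(4)[OF wc] simple[OF a fa] by simp
    finally show "poly q w * adj_fun (poly p) w = zor_poly f a w" using w by simp
  qed
  have 1: "isCont (zor_poly f a) a"
    using holomorphic_on_imp_continuous_on[OF s(3)] s(1)
    by (intro continuous_on_interior[of "cball a s"]) auto
  have 2: "isCont (\<lambda>w. poly q w * adj_fun (poly p) w) a"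
    using holomorphic_on_imp_continuous_on[OF adjh] a
    by (intro continuous_intros continuous_on_interior[of U]) (auto simp: U_def)
  have "(zor_poly f a \<longlongrightarrow> poly q a * adj_fun (poly p) a) (at a)"
    using 2 tendsto_cong[OF ev] by (simp add: isCont_def)
  hence "poly q a * adj_fun (poly p) a = zor_poly f a a"
    using 1 by (intro tendsto_unique[OF at_neq_bot]) (simp_all add: isCont_def)
  hence "poly q a * adj_fun (poly p) a \<noteq> 0" using s(1) s(4)[of a] by auto
  thus "poly q a \<noteq> 0" "poly p (1 / cnj a) \<noteq> 0" by (auto simp: adj_fun_def)
qed

text \<open>On the circle \<open>cnj (poly u z)\<close> involves only nonpositive powers of
  \<open>z\<close>, while \<open>v\<close> involves only nonnegative ones. In degrees:
  \<open>degree v + degree u \<le> degree u\<close>.\<close>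

lemma conj_poly_unit_circle_constant:
  assumes "\<And>z. norm z = 1 \<Longrightarrow> poly v z = cnj (poly u z)"
  obtains c where "u = [:c:]"
proof (cases "u = 0")
  case True thus ?thesis using that[of 0] by simp
next
  case False
  define r where "r = reflect_poly (map_poly cnj u)"
  have degc: "degree (map_poly cnj u) = degree u" by (rule degree_map_poly) auto
  have "v * monom 1 (degree u) = r"
  proof (rule poly_eqI_infinite[OF infinite_unit_circle])
    fix z :: complex assume "z \<in> sphere 0 1"
    hence z: "norm z = 1" "z \<noteq> 0" by auto
    show "poly (v * monom 1 (degree u)) z = poly r z"
      using assms[OF z(1)] z by (simp add: poly_monom r_def poly_reflect_cnj inverse_cnj_unit)
  qed
  moreover have "r \<noteq> 0" using False by (simp add: r_def map_poly_eq_0_iff)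
  ultimately have "v \<noteq> 0" "degree v + degree u = degree r"
    by (auto simp: degree_mult_eq degree_monom_eq)
  moreover have "degree r \<le> degree u" unfolding r_def using degree_reflect_poly_le degc by metis
  ultimately have "degree v = 0" by simp
  then obtain c where c: "v = [:c:]" by (metis degree_eq_zeroE)
  have "u = [:cnj c:]"
  proof (rule poly_eqI_infinite[OF infinite_unit_circle])
    fix z :: complex assume "z \<in> sphere 0 1"
    hence "poly v z = cnj (poly u z)" by (intro assms) simp
    thus "poly u z = poly [:cnj c:] z" unfolding c by (metis complex_cnj_cnj poly_const_conv)
  qed
  thus ?thesis by (rule that)
qed

section \<open>Growth at infinity and the degree bound \<open>N\<close>\<close>

lemma matrix_laurent_polynomial_entries:
  assumes "matrix_laurent_polynomial_of_degree N S"
  obtains C :: "int \<Rightarrow> complex^'m^'m" where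
    "\<And>z i j. z \<noteq> 0 \<Longrightarrow> S z $ i $ j = (\<Sum>n = - int N..int N. C n $ i $ j * z powi n)"
proof -
  obtain C :: "int \<Rightarrow> complex^'m^'m" where
    C: "\<And>z. z \<noteq> 0 \<Longrightarrow> S z = (\<Sum>n = - int N..int N. map_matrix ((*) (z powi n)) (C n))"
    using assms by (auto simp: matrix_laurent_polynomial_of_degree_def)
  show ?thesis by (rule that[of C]) (simp add: C mult.commute)
qed

lemma laurent_mat_of_degree:
  assumes "matrix_laurent_polynomial_of_degree N S" shows "laurent_mat S"
proof -
  obtain C where C: "\<And>z i j. z \<noteq> 0 \<Longrightarrow> S z $ i $ j = (\<Sum>n = - int N..int N. C n $ i $ j * z powi n)"
    using matrix_laurent_polynomial_entries[OF assms] by blast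
  have "laurent (\<lambda>z. S z $ i $ j)" for i j
  proof -
    have "laurent (\<lambda>z. \<Sum>n = - int N..int N. C n $ i $ j * z powi n)"
      by (intro laurent_sum laurent_mult laurent_const laurent_powi)
    thus ?thesis unfolding laurent_def using C by simp
  qed
  thus ?thesis by (simp add: laurent_mat_def)
qed

lemma matrix_laurent_polynomial_growth:
  assumes "matrix_laurent_polynomial_of_degree N S"
  obtains K where "\<And>z i j. norm z \<ge> 1 \<Longrightarrow> norm (S z $ i $ j) \<le> K i j * norm z ^ N"
proof -
  obtain C where C: "\<And>z i j. z \<noteq> 0 \<Longrightarrow> S z $ i $ j = (\<Sum>n = - int N..int N. C n $ i $ j * z powi n)"
    using matrix_laurent_polynomial_entries[OF assms] by blast
  show ?thesis
  proof (rule that[of "\<lambda>i j. \<Sum>n = - int N..int N. norm (C n $ i $ j)"])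
    fix z :: complex and i j assume z: "norm z \<ge> 1"
    hence "z \<noteq> 0" by auto
    have "norm (S z $ i $ j) \<le> (\<Sum>n = - int N..int N. norm (C n $ i $ j * z powi n))"
      unfolding C[OF \<open>z \<noteq> 0\<close>] by (rule norm_sum)
    also have "\<dots> \<le> (\<Sum>n = - int N..int N. norm (C n $ i $ j) * norm z ^ N)"
    proof (rule sum_mono)
      fix n assume "n \<in> {- int N..int N}"
      hence "norm z powi n \<le> norm z powi (int N)" using z by (intro power_int_increasing) auto
      thus "norm (C n $ i $ j * z powi n) \<le> norm (C n $ i $ j) * norm z ^ N"
        by (simp add: norm_mult norm_power_int mult_left_mono)
    qed
    finally show "norm (S z $ i $ j) \<le> (\<Sum>n = - int N..int N. norm (C n $ i $ j)) * norm z ^ N"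
      by (simp add: sum_distrib_right)
  qed
qed

lemma matrix_polynomial_imp_eval_mat:
  assumes "matrix_polynomial N P" obtains Q where "P = eval_mat Q"
proof -
  obtain B where B: "\<And>z. P z = (\<Sum>n\<le>N. map_matrix ((*) (z ^ n)) (B n))"
    using assms by (auto simp: matrix_polynomial_def)
  show ?thesis
    by (rule that[of "\<chi> i j. \<Sum>n\<le>N. monom (B n $ i $ j) n"])
      (simp add: fun_eq_iff vec_eq_iff B poly_sum poly_monom mult.commute)
qed

text \<open>
  Writing \<open>P\<close> as \<open>S\<close> times the inverse of its adjoint, the second factor is bounded near infinity
  because \<open>P(0)\<close> is invertible; so \<open>P\<close> grows no faster than \<open>S\<close>.
\<close>

lemma matrix_polynomial_of_spectral_factor:
  fixes P :: "complex poly^'m^'m"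
  assumes S: "matrix_laurent_polynomial_of_degree N S"
    and PP: "\<And>z. z \<noteq> 0 \<Longrightarrow> eval_mat P z ** adj_mat_fun (eval_mat P) z = S z"
    and P0: "poly (det P) 0 \<noteq> 0"
  shows "matrix_polynomial N (eval_mat P)"
proof -
  have "det P \<noteq> 0" using P0 by auto
  then obtain Q where Q: "Q ** P = det P *\<^sub>m mat 1" using adjugate_poly_mat by blast
  obtain K where K: "\<And>z i j. norm z \<ge> 1 \<Longrightarrow> norm (S z $ i $ j) \<le> K i j * norm z ^ N"
    using matrix_laurent_polynomial_growth[OF S] by blast
  define e where "e = norm (poly (det P) 0) / 2"
  have e: "e > 0" using P0 by (simp add: e_def)
  obtain d where d: "d > 0" "\<And>w. norm w < d \<Longrightarrow> norm (poly (det P) w) \<ge> e"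
  proof -
    have "isCont (poly (det P)) 0" by (rule poly_isCont)
    then obtain d where d: "d > 0" "\<And>w. dist w 0 < d \<Longrightarrow> dist (poly (det P) w) (poly (det P) 0) < e"
      using e unfolding continuous_at_eps_delta by blast
    have "norm (poly (det P) w) \<ge> e" if "norm w < d" for w
    proof -
      have "norm (poly (det P) 0) - norm (poly (det P) w) \<le> norm (poly (det P) 0 - poly (det P) w)"
        by (rule norm_triangle_ineq2)
      also have "\<dots> < e" using d(2)[of w] that by (simp add: dist_norm norm_minus_commute)
      finally show ?thesis by (simp add: e_def)
    qed
    thus ?thesis using that d(1) by blast
  qed
  define M where "M i j = (\<Sum>k\<le>degree (Q $ i $ j). norm (coeff (Q $ i $ j) k))" for i j
  have M: "norm (poly (Q $ i $ j) w) \<le> M i j" if "norm w \<le> 1" for w i j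
  proof -
    have "norm (poly (Q $ i $ j) w) \<le> (\<Sum>k\<le>degree (Q $ i $ j). norm (coeff (Q $ i $ j) k * w ^ k))"
      unfolding poly_altdef by (rule norm_sum)
    also have "\<dots> \<le> M i j"
      unfolding M_def using that
      by (intro sum_mono) (simp add: norm_mult norm_power mult_left_le power_le_one)
    finally show ?thesis .
  qed
  have M0: "M i j \<ge> 0" for i j unfolding M_def by (intro sum_nonneg) auto
  have bound: "norm (poly (P $ i $ j) z) \<le> (\<Sum>l\<in>UNIV. K i l * M j l) / e * norm z ^ N"
    if z: "max 1 (2 / d) \<le> norm z" for i j z
  proof -
    have z1: "norm z \<ge> 1" and z0: "z \<noteq> 0" using z by auto
    \<comment> \<open>Large \<open>z\<close> means small \<open>w\<close>: the lower bound on
      \<open>norm z\<close> puts \<open>w\<close> in the unit disc, where \<open>M\<close> bounds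
      the adjugate \<open>Q\<close>, and within \<open>d\<close> of 0, where \<open>det P\<close>
      stays at least \<open>e\<close> in modulus. The adjugate at \<open>w\<close> replaces the
      inverse of the adjoint of \<open>P\<close>.\<close>
    define w where "w = 1 / cnj z"
    have w1: "norm w \<le> 1" using z1 z0 by (simp add: w_def norm_divide field_simps)
    have "2 / d \<le> norm z" using z by simp
    hence "1 / norm z \<le> d / 2" using d(1) z1 z0 by (simp add: field_simps)
    hence wd: "norm w < d" using d(1) by (simp add: w_def norm_divide)
    have "conj_transpose (eval_mat (Q ** P) w) = cnj (poly (det P) w) *\<^sub>m mat 1"
      unfolding Q by (simp add: vec_eq_iff mat_def)
    hence QP: "conj_transpose (eval_mat P w) ** conj_transpose (eval_mat Q w) = cnj (poly (det P) w) *\<^sub>m mat 1"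
      by (simp add: eval_mat_mult conj_transpose_mult)
    have "S z ** conj_transpose (eval_mat Q w) =
        eval_mat P z ** (conj_transpose (eval_mat P w) ** conj_transpose (eval_mat Q w))"
      using PP[OF z0] by (simp add: adj_mat_fun_def w_def matrix_mul_assoc)
    also have "\<dots> = cnj (poly (det P) w) *\<^sub>m eval_mat P z"
      by (simp add: QP smult_mat_mult_right)
    finally have "cnj (poly (det P) w) * poly (P $ i $ j) z = (S z ** conj_transpose (eval_mat Q w)) $ i $ j"
      by simp
    also have "\<dots> = (\<Sum>l\<in>UNIV. S z $ i $ l * cnj (poly (Q $ j $ l) w))"
      by (simp add: matrix_matrix_mult_def)
    finally have eq: "cnj (poly (det P) w) * poly (P $ i $ j) z = (\<Sum>l\<in>UNIV. S z $ i $ l * cnj (poly (Q $ j $ l) w))" .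
    have "e * norm (poly (P $ i $ j) z) \<le> norm (cnj (poly (det P) w) * poly (P $ i $ j) z)"
      using d(2)[OF wd] by (simp add: norm_mult mult_right_mono)
    also have "\<dots> \<le> (\<Sum>l\<in>UNIV. norm (S z $ i $ l * cnj (poly (Q $ j $ l) w)))"
      unfolding eq by (rule norm_sum)
    also have "\<dots> \<le> (\<Sum>l\<in>UNIV. (K i l * norm z ^ N) * M j l)"
    proof (rule sum_mono)
      fix l
      have "norm (S z $ i $ l) * norm (poly (Q $ j $ l) w) \<le> (K i l * norm z ^ N) * M j l"
        using K[OF z1, of i l] M[OF w1, of j l] M0
        by (intro mult_mono) (auto intro: order_trans[OF norm_ge_zero])
      thus "norm (S z $ i $ l * cnj (poly (Q $ j $ l) w)) \<le> (K i l * norm z ^ N) * M j l"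
        by (simp add: norm_mult)
    qed
    also have "\<dots> = (\<Sum>l\<in>UNIV. K i l * M j l) * norm z ^ N"
      unfolding sum_distrib_right by (intro sum.cong) (simp_all add: mult_ac)
    finally show ?thesis using e by (simp add: field_simps)
  qed
  \<comment> \<open>An entire function of growth order \<open>norm z ^ N\<close> equals its Taylor
    polynomial of degree \<open>N\<close>.\<close>
  have "poly (P $ i $ j) z = (\<Sum>k\<le>N. (deriv ^^ k) (poly (P $ i $ j)) 0 / fact k * z ^ k)" for i j z
  proof (rule Liouville_polynomial)
    show "poly (P $ i $ j) holomorphic_on UNIV" by (intro holomorphic_intros)
  qed (rule bound)
  hence "eval_mat P z = (\<Sum>n\<le>N. map_matrix ((*) (z ^ n)) (\<chi> i j. (deriv ^^ n) (poly (P $ i $ j)) 0 / fact n))" for z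
    by (simp add: vec_eq_iff mult.commute)
  thus ?thesis unfolding matrix_polynomial_def
    by (intro exI[of _ "\<lambda>n. \<chi> i j. (deriv ^^ n) (poly (P $ i $ j)) 0 / fact n"] allI)
qed

text \<open>Instead of moving zeros onto those of \<open>p\<close>, the flips clear the reflections
  of the zeros of \<open>p\<close>. The product of \<open>det P1\<close> and its adjoint vanishes at
  each zero of \<open>p\<close>, so \<open>det P1\<close> must then vanish there itself, and
  simplicity gives \<open>p dvd det P1\<close>. The hypothesis \<open>refl\<close> makes the cleared
  set admissible for \<open>flip_zeros\<close>.\<close>

lemma spectral_factor_exists:
  fixes S :: "complex \<Rightarrow> complex^'m^'m"
  assumes S: "laurent_mat S" "\<And>z. norm z = 1 \<Longrightarrow> pos_definite (S z)"
    and pf: "\<And>z. z \<noteq> 0 \<Longrightarrow> poly p z * adj_fun (poly p) z = det (S z)"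
    and p0: "poly p 0 \<noteq> 0"
    and simple: "\<And>a q. p = [:-a, 1:] * q \<Longrightarrow> poly q a \<noteq> 0"
    and refl: "\<And>a. poly p a = 0 \<Longrightarrow> poly p (1 / cnj a) \<noteq> 0"
  obtains P :: "complex poly^'m^'m" where
    "\<And>z. z \<noteq> 0 \<Longrightarrow> eval_mat P z ** adj_mat_fun (eval_mat P) z = S z" "det P = p"
proof -
  have pn0: "p \<noteq> 0" using p0 by auto
  obtain R :: "complex poly^'m^'m" and \<rho> where R: "\<And>z. norm z = 1 \<Longrightarrow> poly \<rho> z \<noteq> 0"
    "\<And>z. norm z = 1 \<Longrightarrow>
      eval_mat R z ** conj_transpose (eval_mat R z) = (poly \<rho> z * cnj (poly \<rho> z)) *\<^sub>m S z"
    by (rule factor_with_denominator[OF S(1)]) (erule S(2), (rule that; blast))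
  obtain P0 :: "complex poly^'m^'m" where P0:
    "\<And>z. norm z = 1 \<Longrightarrow> eval_mat P0 z ** conj_transpose (eval_mat P0 z) = S z"
    using remove_denominator[OF S(1) _ R] pos_definite_det_nonzero[OF S(2)] by blast
  have "det (eval_mat P0 1) \<noteq> 0"
  proof
    assume "det (eval_mat P0 1) = 0"
    hence "det (S 1) = 0" using P0[of 1] det_mul[of "eval_mat P0 1" "conj_transpose (eval_mat P0 1)"] by simp
    thus False using pos_definite_det_nonzero[OF S(2)[of 1]] by simp
  qed
  hence dP0: "det P0 \<noteq> 0" by (auto simp: det_eval_mat)
  \<comment> \<open>The point 0 is added so that the quotient \<open>e\<close> of
    \<open>det P1\<close> by \<open>p\<close> has no factor \<open>z\<close>, which unimodularity on
    the circle could not exclude.\<close>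
  define A where "A = insert 0 ((\<lambda>a. 1 / cnj a) ` {a. poly p a = 0})"
  have finA: "finite A" unfolding A_def using poly_roots_finite[OF pn0] by simp
  have A: "b * cnj a \<noteq> 1" if ab: "a \<in> A" "b \<in> A" for a b
  proof
    assume eq: "b * cnj a = 1"
    hence "a \<noteq> 0" "b \<noteq> 0" by auto
    then obtain a' b' where a': "poly p a' = 0" "a = 1 / cnj a'" and b': "poly p b' = 0" "b = 1 / cnj b'"
      using ab by (auto simp: A_def)
    have "b' = 1 / cnj a'"
      using eq \<open>a \<noteq> 0\<close> \<open>b \<noteq> 0\<close> a'(2) b'(2)
      by (metis complex_cnj_cnj complex_cnj_divide complex_cnj_one mult.commute divide_divide_eq_right
          mult_1 nonzero_eq_divide_eq)
    thus False using refl[OF a'(1)] b'(1) by simp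
  qed
  obtain P1 :: "complex poly^'m^'m" where P1: "\<And>a. a \<in> A \<Longrightarrow> poly (det P1) a \<noteq> 0"
    "\<And>z. norm z = 1 \<Longrightarrow> eval_mat P1 z ** conj_transpose (eval_mat P1 z) = S z"
    using flip_zeros[OF finA A dP0] P0 by metis
  have PP: "eval_mat P1 z ** adj_mat_fun (eval_mat P1) z = S z" if "z \<noteq> 0" for z
  proof (rule laurent_mat_eqI[OF _ S(1) _ that])
    show "laurent_mat (\<lambda>z. eval_mat P1 z ** adj_mat_fun (eval_mat P1) z)"
      by (intro laurent_mat_mult laurent_mat_adj laurent_mat_eval)
  qed (simp add: adj_mat_fun_unit P1(2))
  have dd: "poly (det P1) z * adj_fun (poly (det P1)) z = poly p z * adj_fun (poly p) z" if "z \<noteq> 0" for z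
  proof -
    have "det (S z) = det (eval_mat P1 z) * det (adj_mat_fun (eval_mat P1) z)"
      by (simp add: det_mul flip: PP[OF that])
    thus ?thesis using pf[OF that] by (simp add: adj_mat_fun_def adj_fun_def det_conj_transpose det_eval_mat)
  qed
  have "p dvd det P1"
  proof (rule simple_roots_dvd[OF pn0 simple])
    fix a assume a: "poly p a = 0"
    hence "a \<noteq> 0" using p0 by auto
    hence "poly (det P1) a * cnj (poly (det P1) (1 / cnj a)) = 0" using dd[of a] a by (simp add: adj_fun_def)
    moreover have "poly (det P1) (1 / cnj a) \<noteq> 0" using a by (intro P1(1)) (simp add: A_def)
    ultimately show "poly (det P1) a = 0" by simp
  qed
  then obtain e where e: "det P1 = p * e" by (auto simp: dvd_def)
  have pT: "poly p z \<noteq> 0" if "norm z = 1" for z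
    using refl[of z] inverse_cnj_unit[OF that] by auto
  have eT: "poly e z * cnj (poly e z) = 1" if z: "norm z = 1" for z
  proof -
    have "z \<noteq> 0" using z by auto
    thus ?thesis using dd[of z] pT[OF z] by (simp add: e adj_fun_unit[OF z] mult_ac)
  qed
  \<comment> \<open>The identity \<open>e * adj_fun e = 1\<close> extends to the punctured plane, so
    a root of \<open>e\<close> could only lie at 0.\<close>
  have "degree e = 0"
  proof (rule ccontr)
    assume "degree e \<noteq> 0"
    then obtain a where a: "poly e a = 0" using alg_closed_imp_poly_has_root[of e] by auto
    have "a \<noteq> 0" using P1(1)[of 0] a by (auto simp: A_def e)
    have "poly e a * adj_fun (poly e) a = 1"
      by (rule laurent_eqI[OF _ laurent_const])
        (use eT \<open>a \<noteq> 0\<close> in \<open>auto simp: adj_fun_unit intro: laurent_mult laurent_poly laurent_adj\<close>)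
    thus False using a by simp
  qed
  then obtain c where c: "e = [:c:]" by (metis degree_eq_zeroE)
  have cc: "c * cnj c = 1" using eT[of 1] by (simp add: c)
  hence c0: "c \<noteq> 0" by auto
  have nc: "norm c = 1"
    using cc by (metis complex_mod_mult_cnj norm_one power2_eq_1_iff norm_ge_zero abs_norm_cancel abs_neg_one
      abs_one)
  \<comment> \<open>Scaling an \<open>m\<close> by \<open>m\<close> matrix by \<open>k\<close>
    multiplies its determinant by \<open>k ^ m\<close>. Since \<open>c\<close> is unimodular, so is
    \<open>k\<close>, and the product of the matrix with its adjoint is unchanged.\<close>
  obtain k where k: "1 / c = k ^ CARD('m)"
    using exists_complex_root[of "CARD('m)" "1 / c"] zero_less_card_finite[where 'a='m] by auto
  have "norm k ^ CARD('m) = 1" using k nc by (metis norm_divide norm_one norm_power div_by_1)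
  hence nk: "norm k = 1" using power_eq_1_iff[of "norm k" "CARD('m)"] by simp
  show ?thesis
  proof (rule that[of "[:k:] *\<^sub>m P1"])
    fix z :: complex assume z: "z \<noteq> 0"
    have "eval_mat ([:k:] *\<^sub>m P1) z ** adj_mat_fun (eval_mat ([:k:] *\<^sub>m P1)) z =
        (k * cnj k) *\<^sub>m (eval_mat P1 z ** adj_mat_fun (eval_mat P1) z)"
      by (simp add: adj_mat_fun_def smult_mat_mult_left smult_mat_mult_right mult_ac)
    thus "eval_mat ([:k:] *\<^sub>m P1) z ** adj_mat_fun (eval_mat ([:k:] *\<^sub>m P1)) z = S z"
      using unit_power_cnj[OF nk, of 1] PP[OF z] by simp
  next
    have "det ([:k:] *\<^sub>m P1) = [:k:] ^ CARD('m) * (p * [:c:])" by (simp add: det_smult_mat e c)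
    also have "[:k:] ^ CARD('m) = [:1 / c:]" by (simp add: k poly_const_pow)
    also have "[:1 / c:] * (p * [:c:]) = p" using c0 by simp
    finally show "det ([:k:] *\<^sub>m P1) = p" .
  qed
qed

lemma spectral_factor_unique:
  fixes P P\<^sub>1 :: "complex poly^'m^'m"
  assumes eq: "\<And>z. z \<noteq> 0 \<Longrightarrow> eval_mat P z ** adj_mat_fun (eval_mat P) z = eval_mat P\<^sub>1 z ** adj_mat_fun (eval_mat P\<^sub>1) z"
    and det: "det P = p" "det P\<^sub>1 = p"
    and p0: "poly p 0 \<noteq> 0"
    and simple: "\<And>a q. p = [:-a, 1:] * q \<Longrightarrow> poly q a \<noteq> 0"
    and refl: "\<And>a. poly p a = 0 \<Longrightarrow> poly p (1 / cnj a) \<noteq> 0"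
  shows "\<exists>U. unitary_matrix U \<and> (\<forall>z. eval_mat P z = eval_mat P\<^sub>1 z ** U)"
proof -
  have pn0: "p \<noteq> 0" using p0 by auto
  obtain Q where Q: "P\<^sub>1 ** Q = p *\<^sub>m mat 1" "Q ** P\<^sub>1 = p *\<^sub>m mat 1"
    using adjugate_poly_mat[of P\<^sub>1] det pn0 by metis
  \<comment> \<open>As \<open>Q\<close> is \<open>p\<close> times the inverse of
    \<open>P\<^sub>1\<close>, \<open>W\<close> is \<open>p\<close> times the quotient sought; that
    the quotient is polynomial amounts to divisibility of \<open>W\<close> by
    \<open>p\<close>.\<close>
  define W where "W = Q ** P"
  have "p dvd W $ i $ j" for i j
  proof (rule simple_roots_dvd[OF pn0 simple])
    fix a assume a: "poly p a = 0"
    hence a0: "a \<noteq> 0" using p0 by auto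
    define b where "b = 1 / cnj a"
    \<comment> \<open>At the reflected point \<open>b\<close> the matrix \<open>P\<close> is
      invertible, so the common product at \<open>a\<close> can be solved for \<open>P(a)\<close>.
      This exhibits \<open>P\<^sub>1(a)\<close> as a left factor, and \<open>Q ** P\<^sub>1\<close>
      vanishes at \<open>a\<close>.\<close>
    have "det (conj_transpose (eval_mat P b)) \<noteq> 0"
      using refl[OF a] by (simp add: b_def det_conj_transpose det_eval_mat det)
    then obtain X where X: "conj_transpose (eval_mat P b) ** X = mat 1"
      using invertible_det_nz by (auto simp: invertible_def)
    have "eval_mat P a = eval_mat P a ** (conj_transpose (eval_mat P b) ** X)" by (simp add: X)
    also have "\<dots> = eval_mat P\<^sub>1 a ** conj_transpose (eval_mat P\<^sub>1 b) ** X"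
      using eq[OF a0] by (simp add: adj_mat_fun_def b_def matrix_mul_assoc)
    finally have "eval_mat W a = eval_mat (Q ** P\<^sub>1) a ** conj_transpose (eval_mat P\<^sub>1 b) ** X"
      by (simp add: W_def eval_mat_mult matrix_mul_assoc)
    also have "eval_mat (Q ** P\<^sub>1) a = 0" using a by (simp add: Q vec_eq_iff)
    finally show "poly (W $ i $ j) a = 0" by (simp add: vec_eq_iff)
  qed
  define U where "U = (\<chi> i j. W $ i $ j div p)"
  have WU: "W = p *\<^sub>m U"
    using \<open>\<And>i j. p dvd W $ i $ j\<close> by (simp add: vec_eq_iff U_def)
  have PU: "P\<^sub>1 ** U = P"
  proof -
    have "P\<^sub>1 ** W = p *\<^sub>m P" by (simp add: W_def matrix_mul_assoc Q smult_mat_mult_left)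
    hence "p *\<^sub>m (P\<^sub>1 ** U) = p *\<^sub>m P" by (simp add: WU smult_mat_mult_right)
    thus ?thesis using pn0 by (simp add: vec_eq_iff)
  qed
  have "p * det U = p" using det_mul[of P\<^sub>1 U] by (simp add: PU det)
  hence "det U = 1" using pn0 by simp
  then obtain V where V: "V ** U = mat 1" using adjugate_poly_mat[of U] by (metis one_neq_zero smult_mat_one)
  have unit: "eval_mat U z ** conj_transpose (eval_mat U z) = mat 1" if z: "norm z = 1" for z
  proof -
    have z0: "z \<noteq> 0" using z by auto
    have "det (eval_mat P\<^sub>1 z) \<noteq> 0"
      using refl[of z] inverse_cnj_unit[OF z] by (auto simp: det_eval_mat det)
    then obtain B where B: "B ** eval_mat P\<^sub>1 z = mat 1"
      using invertible_det_nz by (auto simp: invertible_def)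
    have B': "conj_transpose (eval_mat P\<^sub>1 z) ** conj_transpose B = mat 1"
      using arg_cong[OF B, of conj_transpose] by (simp add: conj_transpose_mult) (simp add: vec_eq_iff mat_def)
    have "eval_mat P\<^sub>1 z ** eval_mat U z ** (conj_transpose (eval_mat U z) ** conj_transpose (eval_mat P\<^sub>1 z))
       = eval_mat P\<^sub>1 z ** conj_transpose (eval_mat P\<^sub>1 z)"
      using eq[OF z0] by (simp add: adj_mat_fun_unit z eval_mat_mult conj_transpose_mult flip: PU)
    hence "B ** (eval_mat P\<^sub>1 z ** eval_mat U z ** (conj_transpose (eval_mat U z) ** conj_transpose (eval_mat P\<^sub>1 z))) ** conj_transpose B
       = B ** (eval_mat P\<^sub>1 z ** conj_transpose (eval_mat P\<^sub>1 z)) ** conj_transpose B" by simp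
    hence "(B ** eval_mat P\<^sub>1 z) ** eval_mat U z ** conj_transpose (eval_mat U z) ** (conj_transpose (eval_mat P\<^sub>1 z) ** conj_transpose B)
       = (B ** eval_mat P\<^sub>1 z) ** (conj_transpose (eval_mat P\<^sub>1 z) ** conj_transpose B)"
      by (simp only: matrix_mul_assoc)
    thus ?thesis by (simp add: B B')
  qed
  have VU: "eval_mat V z = conj_transpose (eval_mat U z)" if z: "norm z = 1" for z
  proof -
    have "eval_mat V z = eval_mat (V ** U) z ** conj_transpose (eval_mat U z)"
      by (simp add: eval_mat_mult unit[OF z] flip: matrix_mul_assoc)
    thus ?thesis by (simp add: V)
  qed
  \<comment> \<open>On the circle the conjugates of the entries of \<open>U\<close> are entries of
    the polynomial matrix \<open>V\<close>, which leaves only constants.\<close>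
  have "\<exists>c. U $ i $ j = [:c:]" for i j
  proof -
    have "poly (V $ j $ i) z = cnj (poly (U $ i $ j) z)" if "norm z = 1" for z
      using VU[OF that] by (metis conj_transpose_nth eval_mat_nth)
    thus ?thesis using conj_poly_unit_circle_constant by blast
  qed
  then obtain c where c: "\<And>i j. U $ i $ j = [:c i j:]" by metis
  hence const: "eval_mat U z = eval_mat U 1" for z by (simp add: vec_eq_iff)
  have "eval_mat U 1 ** conj_transpose (eval_mat U 1) = mat 1" by (rule unit) simp
  hence "unitary_matrix (eval_mat U 1)"
    using matrix_left_right_inverse1 by (auto simp: unitary_matrix_def)
  moreover have "eval_mat P z = eval_mat P\<^sub>1 z ** eval_mat U 1" for z
    by (simp add: eval_mat_mult flip: PU const[of z])
  ultimately show ?thesis by blast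
qed

theorem theorem3:
  fixes S :: "complex \<Rightarrow> complex^'m^'m" and N L :: nat and p :: "complex poly"
  assumes S_laurent: "matrix_laurent_polynomial_of_degree N S"
    and S_pos: "AE t in lebesgue_on {0..2 * pi}. pos_definite (S (cis t))"
    and simple_roots: "\<And>a. a \<noteq> 0 \<Longrightarrow> det (S a) = 0 \<Longrightarrow> zorder (\<lambda>z. det (S z)) a = 1"
    and det_degree: "laurent_polynomial_of_degree L (\<lambda>z. det (S z))"
    and p_degree: "degree p \<le> L"
    and p_factor: "\<And>z. z \<noteq> 0 \<Longrightarrow> poly p z * adj_fun (poly p) z = det (S z)"
  shows "(\<exists>P :: complex \<Rightarrow> complex^'m^'m.
            matrix_polynomial N P \<and>
            (\<forall>z. z \<noteq> 0 \<longrightarrow> P z ** adj_mat_fun P z = S z) \<and>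
            (\<forall>z. det (P z) = poly p z)) \<and>
         (\<forall>P P\<^sub>1 :: complex \<Rightarrow> complex^'m^'m.
            matrix_polynomial N P \<and>
            (\<forall>z. z \<noteq> 0 \<longrightarrow> P z ** adj_mat_fun P z = S z) \<and>
            (\<forall>z. det (P z) = poly p z) \<and>
            matrix_polynomial N P\<^sub>1 \<and>
            (\<forall>z. z \<noteq> 0 \<longrightarrow> P\<^sub>1 z ** adj_mat_fun P\<^sub>1 z = S z) \<and>
            (\<forall>z. det (P\<^sub>1 z) = poly p z) \<longrightarrow>
            (\<exists>U :: complex^'m^'m. unitary_matrix U \<and> (\<forall>z. P z = P\<^sub>1 z ** U)))"
proof -
  have S: "laurent_mat S" using S_laurent by (rule laurent_mat_of_degree)
  have p0: "poly p 0 \<noteq> 0"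
    using laurent_spectral_factor_at_zero[OF det_degree p_degree] p_factor by simp
  have simple: "poly q a \<noteq> 0" if "p = [:-a, 1:] * q" for a q
    using simple_spectral_factor(1)[OF p_factor simple_roots p0 that] .
  have refl: "poly p (1 / cnj a) \<noteq> 0" if "poly p a = 0" for a
  proof -
    obtain q where "p = [:-a, 1:] * q" using \<open>poly p a = 0\<close> by (metis poly_eq_0_iff_dvd dvdE)
    from simple_spectral_factor(2)[OF p_factor simple_roots p0 this] show ?thesis .
  qed
  have pos: "pos_definite (S z)" if z: "norm z = 1" for z
  proof (rule pos_definite_unit_circle[OF S S_pos z])
    \<comment> \<open>A zero of \<open>p\<close> on the circle would be its own reflection, against
      \<open>refl\<close>.\<close>
    have "poly p z \<noteq> 0" using refl[of z] inverse_cnj_unit[OF z] by auto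
    moreover have "z \<noteq> 0" using z by auto
    ultimately show "det (S z) \<noteq> 0" using p_factor[of z] adj_fun_unit[OF z, of "poly p"] by force
  qed
  obtain P :: "complex poly^'m^'m" where P:
    "\<And>z. z \<noteq> 0 \<Longrightarrow> eval_mat P z ** adj_mat_fun (eval_mat P) z = S z" "det P = p"
    using spectral_factor_exists[OF S pos p_factor p0 simple refl] by blast
  show ?thesis
  proof (intro conjI allI impI)
    have "matrix_polynomial N (eval_mat P)"
      by (rule matrix_polynomial_of_spectral_factor[OF S_laurent P(1)]) (simp_all add: P(2) p0)
    thus "\<exists>P. matrix_polynomial N P \<and> (\<forall>z. z \<noteq> 0 \<longrightarrow> P z ** adj_mat_fun P z = S z) \<and>
        (\<forall>z. det (P z) = poly p z)"
      using P by (intro exI[of _ "eval_mat P"]) (simp add: det_eval_mat)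
  next
    fix F F\<^sub>1 :: "complex \<Rightarrow> complex^'m^'m"
    assume *: "matrix_polynomial N F \<and> (\<forall>z. z \<noteq> 0 \<longrightarrow> F z ** adj_mat_fun F z = S z) \<and>
      (\<forall>z. det (F z) = poly p z) \<and> matrix_polynomial N F\<^sub>1 \<and>
      (\<forall>z. z \<noteq> 0 \<longrightarrow> F\<^sub>1 z ** adj_mat_fun F\<^sub>1 z = S z) \<and> (\<forall>z. det (F\<^sub>1 z) = poly p z)"
    obtain Q where Q: "F = eval_mat Q" using * matrix_polynomial_imp_eval_mat by blast
    obtain Q\<^sub>1 where Q\<^sub>1: "F\<^sub>1 = eval_mat Q\<^sub>1" using * matrix_polynomial_imp_eval_mat by blast
    have "det Q = p" "det Q\<^sub>1 = p"
      using * by (simp_all add: Q Q\<^sub>1 det_eval_mat poly_eq_poly_eq_iff[symmetric] fun_eq_iff)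
    thus "\<exists>U. unitary_matrix U \<and> (\<forall>z. F z = F\<^sub>1 z ** U)"
      unfolding Q Q\<^sub>1 using * p0 simple refl
      by (intro spectral_factor_unique[of Q Q\<^sub>1 p]) (auto simp: Q Q\<^sub>1)
  qed
qed

end
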